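(* Let $F$ be a real stable matrix of order $n$, let $\det(sI-F)=s^n+\gamma_{n-1}s^{n-1}+\cdots+\gamma_1 s+\gamma_0$, and suppose that every eigenvalue of $F$ corresponds to only one Jordan block. Suppose there is a real scalar $\beta_0\neq 0$ such that the polynomial $p(s)=s^n+\gamma_{n-1}s^{n-1}+\cdots+\gamma_1 s+\gamma_0-\beta_0$ is stable, and let $n_i$ be the number of pairs of conjugate complex (non-real) roots of $p(s)$. Then there exists a real matrix $H$ of order $n$ such that $F+\alpha H$ has $\left[\frac{n-n_i}{2}\right]+1$ disconnected stable regions with respect to the real parameter $\alpha$.
   Context: A square matrix (respectively, a polynomial) is called stable if all of its eigenvalues (respectively, roots) have strictly negative real part. Roots are counted with multiplicity. $[x]$ denotes the integer part of $x$. For real square matrices $F,H$ of the same order, the stability region (synchronized region) of the pencil $F+\alpha H$ is the set $S=\{\alpha\in\mathbb{R}:\ \alpha<0,\ F+\alpha H \text{ is stable}\}$. The pencil is said to have $k$ disconnected stable regions with respect to $\alpha$ if $S$ consists of $k$ connected components (maximal intervals). *)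

theory Defs
  imports "Jordan_Normal_Form.Jordan_Normal_Form" "HOL-Analysis.Connected"
begin

definition stable_mat :: "real mat \<Rightarrow> bool" where
  "stable_mat A \<longleftrightarrow> (\<forall>z. eigenvalue (map_mat complex_of_real A) z \<longrightarrow> Re z < 0)"

definition stable_poly :: "real poly \<Rightarrow> bool" where
  "stable_poly p \<longleftrightarrow> (\<forall>z. poly (map_poly complex_of_real p) z = 0 \<longrightarrow> Re z < 0)"

(* jordan_nf lists the Jordan blocks as (size, eigenvalue) with positive sizes,
   so distinctness of the second components says one block per eigenvalue. *)
definition one_jordan_block_per_eigenvalue :: "real mat \<Rightarrow> bool" where
  "one_jordan_block_per_eigenvalue A \<longleftrightarrow>
     (\<exists>blocks. jordan_nf (map_mat complex_of_real A) blocks \<and> distinct (map snd blocks))"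

(* Each conjugate pair is represented by its member in the upper half-plane;
   the size of the multiset counts pairs with multiplicity. *)
definition num_conjugate_pairs :: "real poly \<Rightarrow> nat" where
  "num_conjugate_pairs p =
     size (filter_mset (\<lambda>z. Im z > 0) (proots (map_poly complex_of_real p)))"

definition stability_region :: "real mat \<Rightarrow> real mat \<Rightarrow> real set" where
  "stability_region F H = {\<alpha>. \<alpha> < 0 \<and> stable_mat (F + \<alpha> \<cdot>\<^sub>m H)}"

definition has_disconnected_stable_regions :: "real mat \<Rightarrow> real mat \<Rightarrow> nat \<Rightarrow> bool" where
  "has_disconnected_stable_regions F H k \<longleftrightarrow>
     finite (components (stability_region F H)) \<and> card (components (stability_region F H)) = k"

end

theory Submission
  imports Defs "HOL-Analysis.Convex" "HOL-Computational_Algebra.Field_as_Ring"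
    "Jordan_Normal_Form.Jordan_Normal_Form_Uniqueness"
begin

text \<open>
  Write \<open>p\<close> as a product of \<open>m = n - n\<^sub>i\<close> real factors of degree 1 or 2. Since \<open>F\<close> is cyclic, it is similar
  to a matrix with the companion blocks of these factors on the diagonal, joined into a cycle by
  \<open>m\<close> link entries whose product enters the characteristic polynomial only through the constant
  term. Let \<open>H\<close> turn the links into affine functions of \<open>\<alpha>\<close>: the characteristic polynomial of
  \<open>F + \<alpha> H\<close> becomes \<open>p + \<beta>\<^sub>0 (\<Prod>i<m. 1 + c\<^sub>i \<alpha>)\<close>. The shifts \<open>t\<close> for which \<open>p + t\<close> is
  stable form an open interval that contains \<open>0\<close> and \<open>\<beta>\<^sub>0\<close> and is bounded below. If \<open>k = m div 2 > 0\<close>, give the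
  product one steep linear factor and the roots \<open>-1, \<dots>, -k\<close>, all double except \<open>-k\<close>. Then \<open>\<beta>\<^sub>0\<close> times the product
  drops below the interval exactly once between any two neighbours among \<open>0, -1, \<dots>, -k\<close>, by
  log-concavity of products of affine functions between their roots.
\<close>

section \<open>Counting the components of the set of admissible parameters\<close>

text \<open>An affine function that does not change its sign has an affine absolute value, so its
  value in between is a weighted arithmetic mean of the end values. Young's inequality compares this
  with the weighted geometric mean.\<close>

lemma affine_ge_weighted_gm:
  fixes a b x z u v :: real
  assumes "u \<ge> 0" "v \<ge> 0" "u + v = 1" and same: "(a + b * x) * (a + b * z) > 0"
  shows "\<bar>a + b * x\<bar> powr u * \<bar>a + b * z\<bar> powr v \<le> \<bar>a + b * (u * x + v * z)\<bar>"
proof -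
  have v: "v = 1 - u" using \<open>u + v = 1\<close> by simp
  have eq: "a + b * (u * x + v * z) = u * (a + b * x) + v * (a + b * z)"
    unfolding v by (simp add: algebra_simps)
  have abs: "\<bar>a + b * (u * x + v * z)\<bar> = u * \<bar>a + b * x\<bar> + v * \<bar>a + b * z\<bar>"
  proof (cases "a + b * x > 0")
    case True
    with same have "a + b * z > 0" by (simp add: zero_less_mult_iff)
    with True assms(1,2) show ?thesis unfolding eq by simp
  next
    case False
    with same have neg: "a + b * x < 0" "a + b * z < 0" by (auto simp: zero_less_mult_iff)
    then have "u * (a + b * x) + v * (a + b * z) \<le> 0"
      using assms(1,2) by (simp add: add_nonpos_nonpos mult_nonneg_nonpos)
    with neg show ?thesis unfolding eq by (simp add: algebra_simps)
  qed
  have "a + b * x \<noteq> 0" "a + b * z \<noteq> 0" using same by auto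
  then show ?thesis unfolding abs by (intro Youngs_inequality_0) (use assms in auto)
qed

text \<open>Multiplying the bounds for the single factors shows that the absolute value of the
  product is log-concave where no factor changes sign. Only the weaker form with \<open>min\<close>
  is kept: the absolute value cannot dip between two points.\<close>

lemma prod_affine_quasiconcave:
  fixes a b :: "'i \<Rightarrow> real"
  assumes "finite I" and xyz: "x < y" "y < z"
    and same: "\<And>i. i \<in> I \<Longrightarrow> (a i + b i * x) * (a i + b i * z) > 0"
  shows "min \<bar>\<Prod>i\<in>I. a i + b i * x\<bar> \<bar>\<Prod>i\<in>I. a i + b i * z\<bar> \<le> \<bar>\<Prod>i\<in>I. a i + b i * y\<bar>"
proof -
  define u v where "u = (z - y) / (z - x)" and "v = (y - x) / (z - x)"
  have uv: "u \<ge> 0" "v \<ge> 0" "u + v = 1"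
    using xyz by (auto simp: u_def v_def simp flip: add_divide_distrib)
  have "y = u * x + v * z"
  proof -
    have "u * x + v * z = ((z - y) * x + (y - x) * z) / (z - x)"
      by (simp add: u_def v_def add_divide_distrib)
    also have "(z - y) * x + (y - x) * z = y * (z - x)" by (simp add: algebra_simps)
    finally show ?thesis using xyz by simp
  qed
  define X Z where "X = \<bar>\<Prod>i\<in>I. a i + b i * x\<bar>" and "Z = \<bar>\<Prod>i\<in>I. a i + b i * z\<bar>"
  have "X > 0" "Z > 0"
    using same \<open>finite I\<close> unfolding X_def Z_def by fastforce+
  have "X powr u * Z powr v = (\<Prod>i\<in>I. \<bar>a i + b i * x\<bar> powr u * \<bar>a i + b i * z\<bar> powr v)"
    unfolding X_def Z_def abs_prod prod.distrib by (simp add: prod_powr_distrib)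
  also have "\<dots> \<le> (\<Prod>i\<in>I. \<bar>a i + b i * y\<bar>)"
    unfolding \<open>y = u * x + v * z\<close> by (intro prod_mono conjI affine_ge_weighted_gm uv same) simp_all
  also have "\<dots> = \<bar>\<Prod>i\<in>I. a i + b i * y\<bar>" by (simp add: abs_prod)
  finally have le: "X powr u * Z powr v \<le> \<bar>\<Prod>i\<in>I. a i + b i * y\<bar>" .
  have "min X Z = min X Z powr u * min X Z powr v"
    using uv \<open>X > 0\<close> \<open>Z > 0\<close> by (simp flip: powr_add)
  also have "\<dots> \<le> X powr u * Z powr v"
    by (intro mult_mono powr_mono2) (use uv \<open>X > 0\<close> \<open>Z > 0\<close> in auto)
  finally show ?thesis using le unfolding X_def Z_def by linarith
qed

text \<open>After \<open>C\<close> come the slopes 1, 1, 1/2, 1/2, and so on: each 1/j with j < k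
  twice, then 1/k once, which gives the double roots -1, ..., -(k - 1) and the simple root -k. The
  zero slopes fill up the remaining links with factors 1.\<close>

definition link_slope :: "nat \<Rightarrow> real \<Rightarrow> nat \<Rightarrow> real" where
  "link_slope k C i = (if i = 0 then C else if i < 2 * k then 1 / real ((i + 1) div 2) else 0)"

lemma prod_link_slope_upto:
  assumes "k \<ge> 1"
  shows "(\<Prod>i<2 * k. 1 + link_slope k C i * x)
         = (1 + C * x) * ((1 + x / real k) * (\<Prod>j\<in>{1..<k}. 1 + x / real j)\<^sup>2)"
proof -
  \<comment> \<open>Without the cutoff at \<open>2 * k\<close> the factors do not depend on
    \<open>k\<close>, so induction on \<open>k\<close> only appends two of them.\<close>
  define s where "s i = (if i = 0 then C else 1 / real ((i + 1) div 2))" for i :: nat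
  have "(\<Prod>i<2 * k. 1 + s i * x)
         = (1 + C * x) * ((1 + x / real k) * (\<Prod>j\<in>{1..<k}. 1 + x / real j)\<^sup>2)"
    using assms
  proof (induction k rule: dec_induct)
    case base
    show ?case by (simp add: numeral_2_eq_2 s_def)
  next
    case (step k)
    have "s (2 * k) = 1 / real k" "s (Suc (2 * k)) = 1 / real (Suc k)" using step by (auto simp: s_def)
    moreover have "(\<Prod>i<2 * Suc k. 1 + s i * x) = (\<Prod>i<2 * k. 1 + s i * x) * (1 + s (2 * k) * x) * (1 + s (Suc (2 * k)) * x)"
      by simp
    moreover have "(\<Prod>j\<in>{1..<Suc k}. 1 + x / real j) = (\<Prod>j\<in>{1..<k}. 1 + x / real j) * (1 + x / real k)"
      using step by simp
    ultimately show ?case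
      unfolding step.IH by (simp add: power2_eq_square mult_ac del: of_nat_Suc)
  qed
  moreover have "(\<Prod>i<2 * k. 1 + link_slope k C i * x) = (\<Prod>i<2 * k. 1 + s i * x)"
    by (intro prod.cong) (auto simp: link_slope_def s_def)
  ultimately show ?thesis by simp
qed

lemma prod_link_slope:
  assumes "k \<ge> 1" "2 * k \<le> m"
  shows "(\<Prod>i<m. 1 + link_slope k C i * x)
         = (1 + C * x) * ((1 + x / real k) * (\<Prod>j\<in>{1..<k}. 1 + x / real j)\<^sup>2)"
proof -
  have "(\<Prod>i<m. 1 + link_slope k C i * x) = (\<Prod>i<2 * k. 1 + link_slope k C i * x)"
    using assms by (intro prod.mono_neutral_right) (auto simp: link_slope_def)
  with prod_link_slope_upto[OF assms(1)] show ?thesis by simp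
qed


text \<open>A connected set between a piece and \<open>S\<close> is split by that piece and the
  union of the others, both open, so it cannot leave the piece. Hence every piece is a maximal
  connected subset.\<close>

lemma components_open_partition:
  fixes S :: "'a::topological_space set"
  assumes disj: "pairwise disjnt A" and "\<Union> A = S"
    and A: "\<And>X. X \<in> A \<Longrightarrow> open X \<and> connected X \<and> X \<noteq> {}"
  shows "components S = A"
proof -
  have comp: "X \<in> components S" if X: "X \<in> A" for X
    unfolding in_components_maximal
  proof (intro conjI allI impI)
    fix d assume d: "d \<noteq> {} \<and> X \<subseteq> d \<and> d \<subseteq> S \<and> connected d"
    define V where "V = \<Union> (A - {X})"
    have "X \<inter> V = {}" using disj X unfolding V_def pairwise_def disjnt_def by auto
    moreover have "d \<subseteq> X \<union> V" using d \<open>\<Union> A = S\<close> by (auto simp: V_def)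
    moreover have "open X" "open V" using A X by (auto simp: V_def)
    ultimately have "X \<inter> d = {} \<or> V \<inter> d = {}" using d by (intro connectedD) auto
    then show "d = X" using d A[OF X] \<open>d \<subseteq> X \<union> V\<close> by blast
  qed (use A X \<open>\<Union> A = S\<close> in auto)
  show ?thesis
  proof (intro equalityI subsetI)
    fix C assume C: "C \<in> components S"
    then obtain x where "x \<in> C" "x \<in> S"
      using in_components_nonempty in_components_subset by fastforce
    then obtain X where X: "X \<in> A" "x \<in> X" using \<open>\<Union> A = S\<close> by blast
    then have "C = X" using components_eq[OF C comp[OF X(1)]] \<open>x \<in> C\<close> by blast
    with X show "C \<in> A" by simp
  qed (use comp in auto)
qed

text \<open>Let \<open>g\<close> be the scaled product. It takes values in \<open>T\<close> at its
  roots -1, ..., -k and just left of 0, but falls to at most \<open>- P\<close> at the k points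
  halfway between neighbours among 0, -1, ..., -k. These points cut the set into k + 1 pieces, and
  each piece is an interval because it is star-shaped around its centre.\<close>

lemma card_components_prod_links:
  fixes T :: "real set" and \<beta> P :: real
  assumes "open T"
    and conv: "\<And>x y z. \<lbrakk>x \<in> T; z \<in> T; x \<le> y; y \<le> z\<rbrakk> \<Longrightarrow> y \<in> T"
    and "0 \<in> T" "\<beta> \<in> T" "\<beta> \<noteq> 0"
    and lower: "\<And>t. t \<in> T \<Longrightarrow> - P < t"
    and k: "k \<ge> 1" "2 * k \<le> m"
  shows "\<exists>c. card (components {\<alpha>. \<alpha> < 0 \<and> \<beta> * (\<Prod>i<m. 1 + c i * \<alpha>) \<in> T}) = k + 1"
proof -
  have "P > 0" using lower[OF \<open>0 \<in> T\<close>] by simp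
  \<comment> \<open>The separators: \<open>b j\<close> is the midpoint between -j and -(j +
    1).\<close>
  define b :: "nat \<Rightarrow> real" where "b j = - real j - 1/2" for j
  define R where "R x = (1 + x / real k) * (\<Prod>j\<in>{1..<k}. 1 + x / real j)\<^sup>2" for x
  \<comment> \<open>Since every \<open>b j\<close> is at most -1/2, the factor 2 makes
    \<open>\<beta> + C * b j\<close> at most \<open>- (P / R (b j))\<close>, so that
    \<open>g (b j)\<close> is at most \<open>- P\<close>. The final 1 makes \<open>C\<close>
    strictly larger than \<open>2 * \<bar>\<beta>\<bar>\<close>.\<close>
  define C where "C = 2 * (\<bar>\<beta>\<bar> + (\<Sum>j<k. P / \<bar>R (b j)\<bar>)) + 1"
  define g where "g x = (\<beta> + C * x) * R x" for x
  \<comment> \<open>With slope \<open>C / \<beta>\<close> in the first link, the factor \<beta>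
    turns that link into \<open>\<beta> + C * x\<close>, whatever the sign of \<beta>.\<close>
  define c where "c = link_slope k (C / \<beta>)"
  define S where "S = {x. x < 0 \<and> g x \<in> T}"
  have scale: "\<beta> * ((1 + C / \<beta> * x) * y) = (\<beta> + C * x) * y" for x y
  proof -
    have "\<beta> * (1 + C / \<beta> * x) = \<beta> + C * x"
      unfolding distrib_left using \<open>\<beta> \<noteq> 0\<close> by simp
    then show ?thesis unfolding mult.assoc[symmetric] by simp
  qed
  have g_prod: "g x = \<beta> * (\<Prod>i<m. 1 + c i * x)" for x
    unfolding g_def R_def c_def prod_link_slope[OF k] scale by simp
  \<comment> \<open>Absorbing \<beta> into factor 0 writes \<open>g\<close> as a pure product of
    affine functions, the form to which quasiconcavity applies.\<close>
  have g_prod': "g x = (\<Prod>i<2 * k. (if i = 0 then \<beta> else 1) + (if i = 0 then C else c i) * x)" for x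
  proof -
    have "(\<Prod>i<2 * k. (if i = 0 then \<beta> else 1) + (if i = 0 then C else c i) * x)
        = (\<Prod>i<2 * k. (if i = 0 then \<beta> else 1) * (1 + c i * x))"
      using \<open>\<beta> \<noteq> 0\<close> by (intro prod.cong) (auto simp: c_def link_slope_def algebra_simps)
    also have "\<dots> = \<beta> * (\<Prod>i<2 * k. 1 + c i * x)"
      using k by (simp add: prod.distrib prod.delta)
    also have "\<dots> = g x"
      unfolding g_def R_def c_def prod_link_slope_upto[OF k(1)] scale by simp
    finally show ?thesis by simp
  qed
  have R_nonneg: "R x \<ge> 0" if "x \<ge> - real k" for x
    unfolding R_def by (intro mult_nonneg_nonneg) (use that k in \<open>auto simp: field_simps\<close>)
  have R_pos: "R x > 0" if "j < k" "- real j - 1 < x" "x < - real j" for x j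
  proof -
    have "1 + x / real i \<noteq> 0" if "i \<ge> 1" for i
    proof
      assume "1 + x / real i = 0"
      then have "x = - real i" using that by (simp add: field_simps)
      with \<open>- real j - 1 < x\<close> \<open>x < - real j\<close> have "real j < real i" "real i < real (Suc j)" by auto
      then show False unfolding of_nat_less_iff by simp
    qed
    moreover have "1 + x / real k > 0" using that k by (simp add: field_simps)
    ultimately show ?thesis unfolding R_def by simp
  qed
  have R_b: "R (b j) > 0" if "j < k" for j
    using that by (intro R_pos[of j]) (auto simp: b_def)
  have R_le_1: "R x \<le> 1" if "- 1 \<le> x" "x \<le> 0" for x
  proof -
    have *: "0 \<le> 1 + x / real i" "1 + x / real i \<le> 1" if "i \<ge> 1" for i
      using that \<open>- 1 \<le> x\<close> \<open>x \<le> 0\<close> by (auto simp: field_simps)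
    have "(\<Prod>j\<in>{1..<k}. 1 + x / real j) \<le> 1" "(\<Prod>j\<in>{1..<k}. 1 + x / real j) \<ge> 0"
      using * by (auto intro!: prod_le_1 prod_nonneg)
    then have "(\<Prod>j\<in>{1..<k}. 1 + x / real j)\<^sup>2 \<le> 1"
      by (simp add: power_le_one)
    then show ?thesis using *[OF k(1)] unfolding R_def by (intro mult_le_one) auto
  qed
  have R_far: "R x \<le> R y \<and> R y \<le> 0" if "x \<le> y" "y \<le> - real k" for x y
  proof -
    have le: "(\<Prod>j\<in>{1..<k}. 1 + y / real j)\<^sup>2 \<le> (\<Prod>j\<in>{1..<k}. 1 + x / real j)\<^sup>2"
      unfolding prod_power_distrib
    proof (intro prod_mono conjI)
      fix j assume j: "j \<in> {1..<k}"
      then have "real j < real k" by simp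
      then have "1 + x / real j \<le> 1 + y / real j" "1 + y / real j \<le> 0"
        using that j by (auto simp: field_simps)
      then show "(1 + y / real j)\<^sup>2 \<le> (1 + x / real j)\<^sup>2"
        by (simp add: abs_le_square_iff[symmetric])
    qed simp
    have "1 + x / real k \<le> 1 + y / real k" "1 + y / real k \<le> 0"
      using that k by (auto simp: field_simps)
    then have "- (1 + y / real k) * (\<Prod>j\<in>{1..<k}. 1 + y / real j)\<^sup>2
            \<le> - (1 + x / real k) * (\<Prod>j\<in>{1..<k}. 1 + x / real j)\<^sup>2"
      by (intro mult_mono le) auto
    then have "R x \<le> R y" unfolding R_def by (simp only: mult_minus_left neg_le_iff_le)
    moreover have "R y \<le> 0" unfolding R_def
      by (intro mult_nonpos_nonneg \<open>1 + y / real k \<le> 0\<close>) simp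
    ultimately show ?thesis ..
  qed
  define s where "s = (\<Sum>j<k. P / \<bar>R (b j)\<bar>)"
  have "s \<ge> 0" unfolding s_def using \<open>P > 0\<close> by (intro sum_nonneg) simp
  then have "C > 2 * \<bar>\<beta>\<bar>" unfolding C_def s_def[symmetric] by simp
  then have "C > 0" by linarith
  have neg: "\<beta> + C * x < 0" if "x \<le> - 1/2" for x
  proof -
    have "C * x \<le> C * (- 1/2)" using that \<open>C > 0\<close> by (intro mult_left_mono) auto
    with \<open>C > 2 * \<bar>\<beta>\<bar>\<close> show ?thesis by linarith
  qed
  have g_b: "g (b j) \<notin> T" if "j < k" for j
  proof -
    have "P / \<bar>R (b j)\<bar> \<le> s"
      unfolding s_def using that \<open>P > 0\<close> by (intro member_le_sum) auto
    then have "2 * (\<bar>\<beta>\<bar> + P / R (b j)) \<le> C" using R_b[OF that] unfolding C_def s_def[symmetric] by simp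
    moreover have "C * b j \<le> C * (- 1/2)" using \<open>C > 0\<close> by (intro mult_left_mono) (auto simp: b_def)
    moreover have "\<beta> \<le> \<bar>\<beta>\<bar>" by simp
    ultimately have "\<beta> + C * b j \<le> - (P / R (b j))" by (simp add: distrib_left)
    then have "(\<beta> + C * b j) * R (b j) \<le> - (P / R (b j)) * R (b j)"
      using R_b[OF that] by (intro mult_right_mono) auto
    then have "g (b j) \<le> - P" using R_b[OF that] by (simp add: g_def)
    then show ?thesis using lower[of "g (b j)"] by linarith
  qed
  \<comment> \<open>Between -(j + 1) and -j the factors with root -l are negative for l \<le> j and
    positive for l > j. The steep factor has its sign fixed by the two extra assumptions, since it
    may vanish inside the first gap. As \<open>g\<close> is negative at the three points, the lower
    bound on its absolute value becomes an upper bound on \<open>g\<close>.\<close>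
  have key: "g y \<le> max (g x) (g z)"
    if "j < k" "- real j - 1 < x" "x < y" "y < z" "z < - real j" and xz: "\<beta> + C * x < 0" "\<beta> + C * z < 0" for j x y z
  proof -
    have "min \<bar>g x\<bar> \<bar>g z\<bar> \<le> \<bar>g y\<bar>"
      unfolding g_prod'
    proof (rule prod_affine_quasiconcave)
      fix i assume i: "i \<in> {..<2 * k}"
      show "0 < ((if i = 0 then \<beta> else 1) + (if i = 0 then C else c i) * x) *
          ((if i = 0 then \<beta> else 1) + (if i = 0 then C else c i) * z)"
      proof (cases "i = 0")
        case True
        then show ?thesis using xz by (simp add: mult_neg_neg)
      next
        case False
        define l where "l = (i + 1) div 2"
        have "l \<ge> 1" using False by (simp add: l_def)
        have ci: "c i = 1 / real l" using False i by (simp add: c_def link_slope_def l_def)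
        show ?thesis
        proof (cases "l \<le> j")
          case True
          then have "real l \<le> real j" by simp
          then have "1 + x / real l < 0" "1 + z / real l < 0"
            using that \<open>l \<ge> 1\<close> by (auto simp: field_simps)
          then show ?thesis using False by (simp add: ci mult_neg_neg)
        next
          case False
          then have "real j + 1 \<le> real l" by simp
          then have "1 + x / real l > 0" "1 + z / real l > 0"
            using that \<open>l \<ge> 1\<close> by (auto simp: field_simps)
          then show ?thesis using \<open>i \<noteq> 0\<close> by (simp add: ci)
        qed
      qed
    qed (use that in auto)
    moreover have "C * y < C * z" using that \<open>C > 0\<close> by simp
    then have "\<beta> + C * y < 0" using xz by linarith
    then have "g x < 0" "g y < 0" "g z < 0"
      using R_pos[of j x] R_pos[of j y] R_pos[of j z] that by (auto simp: g_def mult_neg_pos)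
    ultimately show ?thesis by (auto simp: min_def max_def split: if_splits)
  qed
  \<comment> \<open>From a point of the piece right of \<open>b j\<close>, moving towards -j stays
    inside. If the steep factor is already nonnegative, then j = 0 and \<open>g y\<close> lies
    between 0 and \<beta>. Otherwise \<open>key\<close> at \<open>b j\<close>, x, y leaves two
    options: \<open>g x \<le> g (b j) \<le> 0\<close> would put \<open>g (b j)\<close> into
    \<open>T\<close>, so \<open>g x \<le> g y < 0\<close>.\<close>
  have right: "g y \<in> T" if "j < k" "b j < x" "x < y" "y < - real j" "g x \<in> T" for j x y
  proof (cases "\<beta> + C * y \<ge> 0")
    case True
    have "j = 0"
    proof (rule ccontr)
      assume "j \<noteq> 0"
      then have "y \<le> - 1/2" using that by simp
      with neg True show False by fastforce
    qed
    with that have y: "- 1 \<le> y" "y \<le> 0" by (auto simp: b_def)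
    have "C * y \<le> 0" using \<open>C > 0\<close> y by (simp add: mult_nonneg_nonpos)
    have "- real k \<le> y" using y k by linarith
    have "g y \<le> (\<beta> + C * y) * 1"
      unfolding g_def by (intro mult_left_mono R_le_1 y True)
    with \<open>C * y \<le> 0\<close> have "g y \<le> \<beta>" by simp
    moreover have "0 \<le> g y" unfolding g_def using True R_nonneg[OF \<open>- real k \<le> y\<close>] by simp
    ultimately show ?thesis using conv[OF \<open>0 \<in> T\<close> \<open>\<beta> \<in> T\<close>] by blast
  next
    case False
    then have "g y < 0" using R_pos[of j y] that by (auto simp: g_def b_def mult_neg_pos)
    have "g x \<le> max (g (b j)) (g y)"
      by (rule key[of j]) (use that neg[of "b j"] False in \<open>auto simp: b_def\<close>)
    then consider "g x \<le> g (b j)" | "g x \<le> g y" by linarith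
    then show ?thesis
    proof cases
      case 1
      have "g (b j) \<le> 0"
        using neg[of "b j"] R_b[OF \<open>j < k\<close>] by (auto simp: g_def b_def mult_nonpos_nonneg)
      with 1 conv[OF \<open>g x \<in> T\<close> \<open>0 \<in> T\<close>] g_b[OF \<open>j < k\<close>] show ?thesis by blast
    next
      case 2
      with \<open>g y < 0\<close> conv[OF \<open>g x \<in> T\<close> \<open>0 \<in> T\<close>] show ?thesis by force
    qed
  qed
  \<comment> \<open>The mirror image of \<open>right\<close>, with \<open>b j\<close> as the right
    end; here the steep factor is always negative.\<close>
  have left: "g y \<in> T" if "j < k" "x < b j" "y < x" "- real j - 1 < y" "g x \<in> T" for j x y
  proof -
    have half: "x \<le> - 1/2" "y \<le> - 1/2" using that by (auto simp: b_def)
    then have "g y < 0" using R_pos[of j y] that neg[of y] by (auto simp: g_def b_def mult_neg_pos)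
    have "g x \<le> max (g y) (g (b j))"
      by (rule key[of j]) (use that neg[of "b j"] neg[OF half(2)] in \<open>auto simp: b_def\<close>)
    then consider "g x \<le> g (b j)" | "g x \<le> g y" by linarith
    then show ?thesis
    proof cases
      case 1
      have "g (b j) \<le> 0"
        using neg[of "b j"] R_b[OF \<open>j < k\<close>] by (auto simp: g_def b_def mult_nonpos_nonneg)
      with 1 conv[OF \<open>g x \<in> T\<close> \<open>0 \<in> T\<close>] g_b[OF \<open>j < k\<close>] show ?thesis by blast
    next
      case 2
      with \<open>g y < 0\<close> conv[OF \<open>g x \<in> T\<close> \<open>0 \<in> T\<close>] show ?thesis by force
    qed
  qed
  \<comment> \<open>Left of the last root the steep factor and \<open>R\<close> are both nonpositive
    and nondecreasing, so \<open>g\<close> is nonnegative and nonincreasing; \<open>g y\<close> lies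
    between 0 and \<open>g x\<close>.\<close>
  have far: "g y \<in> T" if "x < y" "y < - real k" "g x \<in> T" for x y
  proof -
    have "y \<le> - 1/2" using that k by simp
    then have *: "\<beta> + C * y < 0" by (rule neg)
    have "C * x \<le> C * y" using that \<open>C > 0\<close> by simp
    then have **: "\<beta> + C * x \<le> \<beta> + C * y" by simp
    have R: "R x \<le> R y" "R y \<le> 0" using R_far[of x y] that by auto
    have "g y \<ge> 0" using * R by (simp add: g_def mult_nonpos_nonpos)
    moreover have "- (\<beta> + C * y) * - R y \<le> - (\<beta> + C * x) * - R x"
      using * ** R by (intro mult_mono) auto
    then have "g y \<le> g x" by (simp only: g_def minus_mult_minus)
    ultimately show ?thesis using conv[OF \<open>0 \<in> T\<close> \<open>g x \<in> T\<close>] by blast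
  qed
  \<comment> \<open>The cell of -j between its two separators. The cell of 0 ends at 0 itself, and
    the cell of -k is unbounded on the left.\<close>
  define I where "I j = {x. x < 0 \<and> (j < k \<longrightarrow> b j < x) \<and> (j > 0 \<longrightarrow> x < b (j - 1))}" for j
  have star: "g y \<in> T" if "j \<le> k" "x \<in> I j" "g x \<in> T" and y: "x < y \<and> y < - real j \<or> - real j < y \<and> y < x" for j x y
    using y
  proof
    assume y: "x < y \<and> y < - real j"
    show ?thesis
    proof (cases "j < k")
      case True
      with that y show ?thesis by (intro right[of j x y]) (auto simp: I_def)
    next
      case False
      with that y show ?thesis by (intro far[of x y]) auto
    qed
  next
    assume y: "- real j < y \<and> y < x"
    then have "j > 0" using that by (cases j) (auto simp: I_def)
    with that y show ?thesis by (intro left[of "j - 1" x y]) (auto simp: I_def b_def)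
  qed
  have root: "g (- real j) = 0" if "1 \<le> j" "j \<le> k" for j
  proof (cases "j = k")
    case False
    then have "(\<Prod>i\<in>{1..<k}. 1 + - real j / real i) = 0"
      using that by (intro prod_zero) (auto intro!: bexI[of _ j])
    then show ?thesis by (simp add: g_def R_def)
  qed (use that in \<open>simp add: g_def R_def\<close>)
  have cont: "continuous_on UNIV g"
    unfolding g_prod by (intro continuous_intros)
  define X where "X j = I j \<inter> g -` T" for j
  have "open (I j)" for j
    unfolding I_def by (intro open_Collect_conj open_Collect_less open_Collect_imp) (auto intro!: continuous_intros)
  then have "open (X j)" for j
    unfolding X_def using open_vimage[OF \<open>open T\<close> cont] by auto
  moreover have "connected (X j)" if "j \<le> k" for j
  proof (rule connectedI_interval)
    fix u w y assume uw: "u \<in> X j" "w \<in> X j" "u \<le> y" "y \<le> w"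
    then have "y \<in> I j" by (auto simp: X_def I_def)
    moreover have "g y \<in> T"
    proof -
      consider "y = u" | "y = w" | "y = - real j" | "u < y" "y < - real j" | "- real j < y" "y < w"
        using uw by linarith
      then show ?thesis
      proof cases
        case 3
        with \<open>y \<in> I j\<close> have "j \<ge> 1" by (cases j) (auto simp: I_def)
        with root[of j] that 3 \<open>0 \<in> T\<close> show ?thesis by simp
      qed (use uw star[of j] that in \<open>auto simp: X_def\<close>)
    qed
    ultimately show "y \<in> X j" by (simp add: X_def)
  qed
  moreover have "X j \<noteq> {}" if "j \<le> k" for j
  proof (cases "j = 0")
    case True
    \<comment> \<open>The centre 0 is outside its own cell, so a point slightly to its left is found
      by continuity from \<open>g 0 = \<beta>\<close>.\<close>
    have "g 0 \<in> T" using \<open>\<beta> \<in> T\<close> by (simp add: g_def R_def)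
    have "open (g -` T)" using open_vimage[OF \<open>open T\<close> cont] .
    with \<open>g 0 \<in> T\<close> obtain e where e: "e > 0" "\<And>x. dist x 0 < e \<Longrightarrow> g x \<in> T"
      unfolding open_dist by blast
    define x where "x = - min (e / 2) (1 / 4)"
    have "g x \<in> T" using e by (intro e(2)) (auto simp: x_def)
    moreover have "x \<in> I 0" using e by (auto simp: I_def b_def x_def)
    ultimately show ?thesis using True by (auto simp: X_def)
  next
    case False
    then have "- real j \<in> X j" using that root[of j] \<open>0 \<in> T\<close> by (auto simp: X_def I_def b_def)
    then show ?thesis by blast
  qed
  moreover have disj: "X i \<inter> X j = {}" if "i < j" "j \<le> k" for i j
  proof -
    have "b (j - 1) \<le> b i" using that by (auto simp: b_def)
    then show ?thesis using that by (auto simp: X_def I_def)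
  qed
  moreover have "\<Union> (X ` {..k}) = S"
  proof
    show "S \<subseteq> \<Union> (X ` {..k})"
    proof
      fix x assume x: "x \<in> S"
      \<comment> \<open>The first separator to the left of x determines its cell; \<open>k\<close>
        serves as the fallback when there is none. A separator never belongs to \<open>S\<close>, so
        x is strictly between two of them.\<close>
      define j where "j = (LEAST j. j < k \<longrightarrow> b j < x)"
      have j: "j < k \<longrightarrow> b j < x" unfolding j_def by (rule LeastI[of _ k]) simp
      have "j \<le> k" unfolding j_def by (rule Least_le) simp
      have "x < b (j - 1)" if "j > 0"
      proof -
        have *: "j - 1 < k" "\<not> b (j - 1) < x"
          using not_less_Least[of "j - 1" "\<lambda>j. j < k \<longrightarrow> b j < x"] that unfolding j_def by auto
        then show ?thesis using g_b[OF *(1)] x by (cases "x = b (j - 1)") (auto simp: S_def)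
      qed
      with j x have "x \<in> X j" by (auto simp: X_def I_def S_def)
      with \<open>j \<le> k\<close> show "x \<in> \<Union> (X ` {..k})" by blast
    qed
  qed (auto simp: X_def I_def S_def)
  ultimately have "components S = X ` {..k}"
  proof (intro components_open_partition)
    show "pairwise disjnt (X ` {..k})"
      unfolding pairwise_def disjnt_def
    proof (intro ballI impI)
      fix A B assume "A \<in> X ` {..k}" "B \<in> X ` {..k}" "A \<noteq> B"
      then obtain i j where "A = X i" "B = X j" "i \<le> k" "j \<le> k" "i \<noteq> j" by auto
      with disj[of i j] disj[of j i] show "A \<inter> B = {}" by (cases "i < j") auto
    qed
  qed auto
  moreover have "inj_on X {..k}"
  proof (rule linorder_inj_onI)
    fix i j assume "i < j" "i \<in> {..k}" "j \<in> {..k}"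
    with disj[of i j] \<open>\<And>j. j \<le> k \<Longrightarrow> X j \<noteq> {}\<close> show "X i \<noteq> X j" by fastforce
  qed auto
  ultimately have "card (components S) = k + 1" by (simp add: card_image)
  then show ?thesis unfolding S_def g_prod by blast
qed

section \<open>Stability under constant shifts\<close>

abbreviation cpoly :: "real poly \<Rightarrow> complex poly" where
  "cpoly \<equiv> map_poly complex_of_real"

interpretation cpoly_hom: map_poly_inj_idom_hom complex_of_real ..

lemma poly_cpoly_shift: "poly (cpoly (p + [:b:])) z = poly (cpoly p) z + of_real b"
  by (simp add: hom_distribs)

lemma lead_coeff_shift:
  fixes p :: "'a::comm_ring_1 poly"
  assumes "degree p \<ge> 1"
  shows "degree (p + [:b:]) = degree p" "lead_coeff (p + [:b:]) = lead_coeff p"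
proof -
  have "degree [:b:] < degree p" using assms by (simp add: degree_pCons_eq_if)
  then show "degree (p + [:b:]) = degree p" "lead_coeff (p + [:b:]) = lead_coeff p"
    by (simp_all add: degree_add_eq_left lead_coeff_add_le coeff_eq_0)
qed

lemma norm_prod_list_ge:
  fixes as :: "complex list"
  assumes "e > 0" "\<And>a. a \<in> set as \<Longrightarrow> e \<le> norm (w - a)"
  shows "e ^ length as \<le> norm (poly (\<Prod>a\<leftarrow>as. [:- a, 1:]) w)"
  using assms(2)
proof (induction as)
  case (Cons a as)
  have "e * e ^ length as \<le> norm (w - a) * norm (poly (\<Prod>a\<leftarrow>as. [:- a, 1:]) w)"
    using Cons \<open>e > 0\<close> by (intro mult_mono) auto
  also have "\<dots> = norm (poly (\<Prod>a\<leftarrow>a # as. [:- a, 1:]) w)"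
    unfolding norm_mult[symmetric] by (simp add: algebra_simps)
  finally show ?case by simp
qed simp

text \<open>The absolute value of a monic polynomial is the product of the distances to its roots,
  so not all of them can be at least \<open>e\<close>. This serves as a quantitative form of the
  continuity of roots.\<close>

lemma monic_root_near:
  fixes q :: "complex poly"
  assumes "monic q" "e > 0" "norm (poly q w) < e ^ degree q"
  shows "\<exists>a. poly q a = 0 \<and> norm (w - a) < e"
proof -
  obtain as where as: "q = (\<Prod>a\<leftarrow>as. [:- a, 1:])" "length as = degree q"
    using fundamental_theorem_algebra_factorized[of q] \<open>monic q\<close> by auto
  then have "\<exists>a\<in>set as. norm (w - a) < e"
    using norm_prod_list_ge[OF \<open>e > 0\<close>, of as w] assms(3) by force
  then show ?thesis unfolding as(1) by (auto simp: poly_prod_list prod_list_zero_iff image_iff)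
qed

lemma poly_pderiv_prod_list_roots:
  fixes as :: "complex list"
  assumes "w \<notin> set as"
  shows "poly (pderiv (\<Prod>a\<leftarrow>as. [:- a, 1:])) w
         = poly (\<Prod>a\<leftarrow>as. [:- a, 1:]) w * (\<Sum>a\<leftarrow>as. 1 / (w - a))"
  using assms
proof (induction as)
  case (Cons a as)
  define Q where "Q = (\<Prod>a\<leftarrow>as. [:- a, 1:])"
  have "poly (pderiv ([:- a, 1:] * Q)) w = (w - a) * poly (pderiv Q) w + poly Q w"
    unfolding pderiv_mult by (simp add: pderiv_pCons algebra_simps)
  moreover have "w - a \<noteq> 0" using Cons.prems by auto
  ultimately show ?case using Cons by (simp flip: Q_def del: mult_pCons_left) (simp add: field_simps)
qed simp

text \<open>The argument of a stable polynomial increases strictly along the imaginary axis.\<close>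

lemma stable_log_deriv_pos:
  fixes q :: "complex poly"
  assumes "monic q" "degree q \<ge> 1" and stable: "\<And>z. poly q z = 0 \<Longrightarrow> Re z < 0" and "Re w = 0"
  shows "Re (poly (pderiv q) w / poly q w) > 0"
proof -
  obtain as where as: "q = (\<Prod>a\<leftarrow>as. [:- a, 1:])" "length as = degree q"
    using fundamental_theorem_algebra_factorized[of q] \<open>monic q\<close> by auto
  have neg: "Re a < 0" if "a \<in> set as" for a
    using that by (intro stable) (auto simp: as(1) poly_prod_list prod_list_zero_iff)
  have "w \<notin> set as" using neg \<open>Re w = 0\<close> by force
  have "poly q w \<noteq> 0" using stable[of w] \<open>Re w = 0\<close> by auto
  have "poly (pderiv q) w / poly q w = (\<Sum>a\<leftarrow>as. 1 / (w - a))"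
    using poly_pderiv_prod_list_roots[OF \<open>w \<notin> set as\<close>] \<open>poly q w \<noteq> 0\<close>
    by (simp flip: as(1))
  moreover have "Re (\<Sum>a\<leftarrow>bs. 1 / (w - a)) > 0" if "set bs \<subseteq> set as" "bs \<noteq> []" for bs
    using that
  proof (induction bs)
    case (Cons b bs)
    have "Re (1 / (w - b)) > 0"
      using neg[of b] Cons.prems \<open>Re w = 0\<close>
      by (auto simp: Re_divide intro!: divide_neg_pos add_pos_nonneg)
    moreover have "Re (\<Sum>a\<leftarrow>bs. 1 / (w - a)) \<ge> 0"
      using Cons by (cases "bs = []") auto
    ultimately show ?case by simp
  qed simp
  moreover have "as \<noteq> []" using as(2) assms(2) by auto
  ultimately show ?thesis by simp
qed

lemma stable_poly_shift_iff:
  "stable_poly (p + [:b:]) \<longleftrightarrow> (\<forall>z. poly (cpoly p) z + of_real b = 0 \<longrightarrow> Re z < 0)"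
  unfolding stable_poly_def poly_cpoly_shift ..

context
  fixes p :: "real poly"
  assumes p: "monic p" "degree p \<ge> 1"
begin

lemma monic_cpoly_shift: "monic (cpoly (p + [:b:]))" "degree (cpoly (p + [:b:])) = degree p"
  using lead_coeff_shift[OF p(2), of b] p by auto

text \<open>If a nearby shift had a root w with nonnegative real part, the given polynomial would be
  small at w and so have a root closer to w than its roots are to the imaginary axis.\<close>

lemma open_stable_shifts: "open {b. stable_poly (p + [:b:])}"
  unfolding open_dist
proof (intro ballI, unfold mem_Collect_eq)
  fix b assume b: "stable_poly (p + [:b:])"
  define Z where "Z = {z. poly (cpoly (p + [:b:])) z = 0}"
  have "cpoly (p + [:b:]) \<noteq> 0" using monic_cpoly_shift[of b] by force
  then have "finite Z" unfolding Z_def by (rule poly_roots_finite)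
  \<comment> \<open>A lower bound for the distances of the roots to the imaginary axis; the inserted
    1 ensures that the minimum is over a nonempty set.\<close>
  define e where "e = Min (insert 1 ((\<lambda>z. - Re z) ` Z))"
  have "e > 0" using \<open>finite Z\<close> b unfolding e_def by (auto simp: stable_poly_def Z_def)
  have le: "e \<le> - Re z" if "z \<in> Z" for z
    unfolding e_def using \<open>finite Z\<close> that by (intro Min_le) auto
  have "stable_poly (p + [:b':])" if "dist b' b < e ^ degree p" for b'
    unfolding stable_poly_shift_iff
  proof (intro allI impI, rule ccontr)
    fix w assume w: "poly (cpoly p) w + of_real b' = 0" "\<not> Re w < 0"
    have "poly (cpoly (p + [:b:])) w = of_real (b - b')"
      using w(1) unfolding poly_cpoly_shift by (simp add: add_eq_0_iff)
    then have "norm (poly (cpoly (p + [:b:])) w) < e ^ degree (cpoly (p + [:b:]))"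
      using that unfolding monic_cpoly_shift by (simp only: norm_of_real) (simp add: dist_real_def abs_minus_commute)
    then obtain a where "poly (cpoly (p + [:b:])) a = 0" "norm (w - a) < e"
      using monic_root_near[OF monic_cpoly_shift(1) \<open>e > 0\<close>] by blast
    with le[of a] w(2) complex_Re_le_cmod[of "w - a"] show False by (simp add: Z_def)
  qed
  then show "\<exists>e>0. \<forall>b'. dist b' b < e \<longrightarrow> stable_poly (p + [:b':])"
    using \<open>e > 0\<close> by (intro exI[of _ "e ^ degree p"]) auto
qed

text \<open>The counterpart of the stable shifts: where no root lies on the imaginary axis, every
  shift belongs to exactly one of these two open sets.\<close>

lemma open_right_half_plane_shifts: "open {b. \<exists>z. Re z > 0 \<and> poly (cpoly p) z + of_real b = 0}"
  unfolding open_dist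
proof (intro ballI, unfold mem_Collect_eq)
  fix b assume "\<exists>z. Re z > 0 \<and> poly (cpoly p) z + of_real b = 0"
  then obtain z where z: "Re z > 0" "poly (cpoly p) z + of_real b = 0" by blast
  have "\<exists>z. Re z > 0 \<and> poly (cpoly p) z + of_real b' = 0" if "dist b' b < Re z ^ degree p" for b'
  proof -
    have "poly (cpoly (p + [:b':])) z = of_real (b' - b)"
      using z(2) unfolding poly_cpoly_shift by (simp add: add_eq_0_iff)
    then have "norm (poly (cpoly (p + [:b':])) z) < Re z ^ degree (cpoly (p + [:b':]))"
      using that unfolding monic_cpoly_shift by (simp only: norm_of_real) (simp add: dist_real_def)
    then obtain a where "poly (cpoly (p + [:b':])) a = 0" "norm (z - a) < Re z"
      using monic_root_near[OF monic_cpoly_shift(1) z(1)] by blast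
    with complex_Re_le_cmod[of "z - a"] show ?thesis
      unfolding poly_cpoly_shift by (intro exI[of _ a]) auto
  qed
  then show "\<exists>e>0. \<forall>b'. dist b' b < e \<longrightarrow> (\<exists>z. Re z > 0 \<and> poly (cpoly p) z + of_real b' = 0)"
    using z(1) by (intro exI[of _ "Re z ^ degree p"]) auto
qed

text \<open>Constants are a convex direction for stability: an intermediate shift cannot create a root
  on the imaginary axis, because there the two stable endpoints take real values of opposite sign,
  while sharing the same derivative.\<close>

lemma stable_shifts_convex:
  assumes "stable_poly (p + [:b1:])" "stable_poly (p + [:b2:])" "b1 \<le> b" "b \<le> b2"
  shows "stable_poly (p + [:b:])"
proof -
  have axis: "Re w \<noteq> 0" if c: "c \<in> {b1..b2}" and w: "poly (cpoly p) w + of_real c = 0" for c w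
  proof
    assume "Re w = 0"
    then have "c \<noteq> b1" "c \<noteq> b2"
      using assms(1,2) w unfolding stable_poly_shift_iff by fastforce+
    with c have "b1 - c < 0" "b2 - c > 0" by auto
    define d where "d = poly (pderiv (cpoly p)) w"
    have "Re (d / of_real (b' - c)) > 0" if "stable_poly (p + [:b':])" for b'
    proof -
      have "poly (cpoly (p + [:b':])) w = of_real (b' - c)"
        using w unfolding poly_cpoly_shift by (simp add: add_eq_0_iff)
      moreover have "pderiv (cpoly (p + [:b':])) = pderiv (cpoly p)"
        by (simp add: hom_distribs pderiv_add pderiv_pCons)
      ultimately show ?thesis
        using stable_log_deriv_pos[of "cpoly (p + [:b':])" w] monic_cpoly_shift[of b'] p(2) that \<open>Re w = 0\<close>
        unfolding d_def stable_poly_def by metis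
    qed
    from this[OF assms(1)] this[OF assms(2)] have "Re d / (b1 - c) > 0" "Re d / (b2 - c) > 0"
      unfolding Re_divide_of_real by simp_all
    with \<open>b1 - c < 0\<close> \<open>b2 - c > 0\<close> show False by (auto simp: zero_less_divide_iff)
  qed
  \<comment> \<open>Without roots on the axis the disjoint open sets \<open>T\<close> and
    \<open>U\<close> cover \<open>{b1..b2}\<close>; the interval is connected and contains the
    stable shift \<open>b1\<close>, so it avoids \<open>U\<close>.\<close>
  define T where "T = {b. stable_poly (p + [:b:])}"
  define U where "U = {b. \<exists>z. Re z > 0 \<and> poly (cpoly p) z + of_real b = 0}"
  have "T \<inter> U \<inter> {b1..b2} = {}"
    unfolding T_def U_def stable_poly_shift_iff by fastforce
  moreover have "{b1..b2} \<subseteq> T \<union> U"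
  proof
    fix c assume "c \<in> {b1..b2}"
    from axis[OF this] show "c \<in> T \<union> U"
      unfolding T_def U_def stable_poly_shift_iff by (force simp: not_less order_le_less)
  qed
  moreover have "open T" "open U"
    unfolding T_def U_def by (fact open_stable_shifts open_right_half_plane_shifts)+
  ultimately have "T \<inter> {b1..b2} = {} \<or> U \<inter> {b1..b2} = {}"
    by (intro connectedD connected_Icc)
  moreover have "b1 \<in> T \<inter> {b1..b2}" using assms by (simp add: T_def)
  moreover have "b \<in> {b1..b2}" using assms(3,4) by simp
  ultimately have "b \<in> T" using \<open>{b1..b2} \<subseteq> T \<union> U\<close> by blast
  then show ?thesis by (simp add: T_def)
qed

text \<open>A monic polynomial with nonpositive value at 0 has a nonnegative real root by the
  intermediate value theorem, so the constant term after a stable shift is positive.\<close>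

lemma stable_shift_lower_bound:
  assumes "stable_poly (p + [:b:])"
  shows "- poly p 0 < b"
proof (rule ccontr)
  assume "\<not> - poly p 0 < b"
  then have le: "poly (p + [:b:]) 0 \<le> 0" by simp
  have "lead_coeff (p + [:b:]) = 1" using lead_coeff_shift[OF p(2), of b] p by simp
  then obtain M where M: "\<And>x. x \<ge> M \<Longrightarrow> poly (p + [:b:]) x \<ge> 1"
    using poly_pinfty_gt_lc[of "p + [:b:]"] by auto
  have "poly (p + [:b:]) (max M 1) > 0" using M[of "max M 1"] by simp
  have "\<exists>x\<ge>0. poly (p + [:b:]) x = 0"
  proof (cases "poly (p + [:b:]) 0 = 0")
    case False
    with le have "poly (p + [:b:]) 0 < 0" by linarith
    moreover have "0 < max M 1" by linarith
    ultimately show ?thesis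
      using poly_IVT_pos[of 0 "max M 1" "p + [:b:]"] \<open>poly (p + [:b:]) (max M 1) > 0\<close> less_imp_le by blast
  qed auto
  then obtain x where x: "x \<ge> 0" "poly (p + [:b:]) x = 0" by blast
  have "poly (cpoly (p + [:b:])) (complex_of_real x) = complex_of_real (poly (p + [:b:]) x)" by simp
  then have "poly (cpoly (p + [:b:])) (complex_of_real x) = 0" unfolding x(2) by simp
  with assms have "Re (complex_of_real x) < 0" unfolding stable_poly_def by blast
  with x show False by simp
qed

end

section \<open>Three-term recurrences\<close>

lemma num_conjugate_pairs_mult:
  assumes "p \<noteq> 0" "q \<noteq> 0"
  shows "num_conjugate_pairs (p * q) = num_conjugate_pairs p + num_conjugate_pairs q"
  using assms by (simp add: num_conjugate_pairs_def cpoly_hom.hom_mult proots_mult)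

lemma num_conjugate_pairs_linear: "num_conjugate_pairs [:- r, 1:] = 0"
  by (simp add: num_conjugate_pairs_def)

definition conj_quadratic :: "complex \<Rightarrow> real poly" where
  "conj_quadratic z = [:(Re z)\<^sup>2 + (Im z)\<^sup>2, - 2 * Re z, 1:]"

lemma cpoly_conj_quadratic: "cpoly (conj_quadratic z) = [:- z, 1:] * [:- cnj z, 1:]"
  by (auto simp: conj_quadratic_def complex_eq_iff power2_eq_square)

lemma num_conjugate_pairs_quadratic:
  assumes "Im z > 0"
  shows "num_conjugate_pairs (conj_quadratic z) = 1"
proof -
  have "proots ([:- z, 1:] * [:- cnj z, 1:]) = {#z, cnj z#}"
    by (subst proots_mult) auto
  with assms show ?thesis
    unfolding num_conjugate_pairs_def cpoly_conj_quadratic by simp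
qed

text \<open>The remainder modulo the quadratic is a real polynomial a + b x that vanishes at the
  non-real z, so a = b = 0.\<close>

lemma conj_quadratic_dvd:
  assumes "poly (cpoly p) z = 0" "Im z \<noteq> 0"
  shows "conj_quadratic z dvd p"
proof -
  define Q where "Q = conj_quadratic z"
  define r where "r = p mod Q"
  have "Q \<noteq> 0" "degree Q = 2" by (auto simp: Q_def conj_quadratic_def)
  then have "degree r \<le> 1" unfolding r_def using degree_mod_less[of Q p] by auto
  then have "r = [:coeff r 0, coeff r 1:]"
    by (intro poly_eqI) (auto simp: coeff_pCons coeff_eq_0 split: nat.split)
  then obtain a b where r: "r = [:a, b:]" by blast
  have "p = p div Q * Q + r" by (simp add: r_def)
  then have "cpoly p = cpoly (p div Q) * cpoly Q + cpoly r" by (metis cpoly_hom.hom_add cpoly_hom.hom_mult)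
  then have "poly (cpoly p) z = poly (cpoly (p div Q)) z * poly (cpoly Q) z + poly (cpoly r) z" by simp
  moreover have "poly (cpoly Q) z = 0" unfolding Q_def cpoly_conj_quadratic poly_mult by simp
  ultimately have "poly (cpoly r) z = 0" using assms(1) by simp
  then have "of_real a + z * of_real b = 0" by (simp add: r hom_distribs)
  then have "b = 0" "a = 0" using assms(2) by (auto simp: complex_eq_iff)
  then have "p mod Q = 0" using r by (simp add: r_def)
  then show ?thesis by (simp add: Q_def mod_eq_0_iff_dvd)
qed

lemma real_linear_or_quadratic_factor:
  fixes p :: "real poly"
  assumes "degree p \<ge> 1"
  shows "(\<exists>r. [:- r, 1:] dvd p) \<or> (\<exists>z. Im z > 0 \<and> conj_quadratic z dvd p)"
proof -
  have "\<not> constant (poly (cpoly p))" using assms by (simp add: constant_degree)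
  then obtain z where z: "poly (cpoly p) z = 0"
    using fundamental_theorem_of_algebra by blast
  have cz: "poly (cpoly p) (cnj z) = 0"
    using z poly_cnj_real[of "cpoly p" z] by (simp add: coeff_map_poly)
  consider "Im z = 0" | "Im z > 0" | "Im (cnj z) > 0" by fastforce
  then show ?thesis
  proof cases
    case 1
    then have "z = of_real (Re z)" by (simp add: complex_eq_iff)
    with z have "poly p (Re z) = 0" by (metis of_real_eq_0_iff of_real_hom.poly_map_poly)
    then show ?thesis by (auto simp: poly_eq_0_iff_dvd)
  next
    case 2
    then show ?thesis using conj_quadratic_dvd[OF z] by auto
  next
    case 3
    then show ?thesis using conj_quadratic_dvd[OF cz] by (intro disjI2 exI[of _ "cnj z"]) auto
  qed
qed

text \<open>The partial products of a factorization into linear and quadratic factors satisfy a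
  three-term recurrence whose coefficient \<open>e (Suc j)\<close> vanishes exactly at the end of a factor.\<close>

lemma exists_three_term_recurrence:
  fixes p :: "real poly"
  assumes "monic p"
  shows "\<exists>d e q. q 0 = 1 \<and> (\<forall>j<degree p. q (Suc j) = [:- d j, 1:] * q j - Polynomial.smult (e j) (q (j - 1)))
     \<and> q (degree p) = p \<and> e 0 = 0 \<and> (\<forall>j\<ge>degree p. e j = 0)
     \<and> card {j. j < degree p \<and> e (Suc j) = 0} + num_conjugate_pairs p = degree p"
  using assms
proof (induction "degree p" arbitrary: p rule: less_induct)
  case less
  show ?case
  proof (cases "degree p = 0")
    case True
    with less.prems have "p = 1" by (metis monic_degree_0)
    then show ?thesis
      by (intro exI[of _ "\<lambda>_. 0"] exI[of _ "\<lambda>_. 1"]) (simp add: num_conjugate_pairs_def)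
  next
    case False
    then consider r where "[:- r, 1:] dvd p" | z where "Im z > 0" "conj_quadratic z dvd p"
      using real_linear_or_quadratic_factor[of p] by auto
    then show ?thesis
    proof cases
      case 1
      then obtain p' where p: "p = [:- r, 1:] * p'" by (elim dvdE)
      have "monic p'" using less.prems unfolding p lead_coeff_mult by simp
      then have "p' \<noteq> 0" by force
      define n where "n = degree p'"
      have deg: "degree p = Suc n" using \<open>p' \<noteq> 0\<close> unfolding p n_def by (subst degree_mult_eq) auto
      obtain d e q where IH: "q 0 = 1" "\<And>j. j < n \<Longrightarrow> q (Suc j) = [:- d j, 1:] * q j - Polynomial.smult (e j) (q (j - 1))"
        "q n = p'" "e 0 = 0" "\<And>j. j \<ge> n \<Longrightarrow> e j = 0"
        "card {j. j < n \<and> e (Suc j) = 0} + num_conjugate_pairs p' = n"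
        using less.hyps[of p'] \<open>monic p'\<close> deg unfolding n_def by auto
      \<comment> \<open>Because \<open>e n = 0\<close>, the next step merely multiplies by x - r. It
        ends a factor, so the index \<open>n\<close> joins the counted set.\<close>
      define d' where "d' = d(n := r)"
      define q' where "q' = q(Suc n := p)"
      have "q' (Suc j) = [:- d' j, 1:] * q' j - Polynomial.smult (e j) (q' (j - 1))" if "j < Suc n" for j
        using that IH(2)[of j] IH(3) IH(5)[of n] p unfolding d'_def q'_def by (cases "j = n") auto
      moreover have "{j. j < Suc n \<and> e (Suc j) = 0} = insert n {j. j < n \<and> e (Suc j) = 0}"
        using IH(5)[of "Suc n"] by auto
      then have "card {j. j < Suc n \<and> e (Suc j) = 0} = Suc (card {j. j < n \<and> e (Suc j) = 0})" by simp
      moreover have "num_conjugate_pairs p = num_conjugate_pairs p'"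
        unfolding p using \<open>p' \<noteq> 0\<close> by (subst num_conjugate_pairs_mult) (auto simp: num_conjugate_pairs_linear)
      ultimately show ?thesis
        unfolding deg using IH by (intro exI[of _ d'] exI[of _ e] exI[of _ q']) (auto simp: q'_def)
    next
      case 2
      then obtain p' where p: "p = conj_quadratic z * p'" by (elim dvdE)
      have Q: "monic (conj_quadratic z)" "conj_quadratic z \<noteq> 0" "degree (conj_quadratic z) = 2"
        by (auto simp: conj_quadratic_def)
      have "monic p'" using less.prems Q unfolding p lead_coeff_mult by simp
      then have "p' \<noteq> 0" by force
      define n where "n = degree p'"
      have deg: "degree p = Suc (Suc n)" using \<open>p' \<noteq> 0\<close> Q unfolding p n_def by (subst degree_mult_eq) auto
      obtain d e q where IH: "q 0 = 1" "\<And>j. j < n \<Longrightarrow> q (Suc j) = [:- d j, 1:] * q j - Polynomial.smult (e j) (q (j - 1))"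
        "q n = p'" "e 0 = 0" "\<And>j. j \<ge> n \<Longrightarrow> e j = 0"
        "card {j. j < n \<and> e (Suc j) = 0} + num_conjugate_pairs p' = n"
        using less.hyps[of p'] \<open>monic p'\<close> deg unfolding n_def by auto
      \<comment> \<open>The quadratic is x (x - 2 Re z) + c. Its two steps have diagonal entries 0
        and 2 Re z and are coupled by \<open>- c\<close>. As c > 0, only the second step ends a
        factor, which accounts for one conjugate pair.\<close>
      define d' where "d' = d(n := 0, Suc n := 2 * Re z)"
      define c where "c = (Re z)\<^sup>2 + (Im z)\<^sup>2"
      define e' where "e' = e(Suc n := - c)"
      define q' where "q' = q(Suc n := [:0, 1:] * p', Suc (Suc n) := p)"
      have "c > 0" unfolding c_def using \<open>Im z > 0\<close> by (intro add_nonneg_pos) auto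
      then have "e' (Suc n) \<noteq> 0" unfolding e'_def by simp
      have "q' (Suc j) = [:- d' j, 1:] * q' j - Polynomial.smult (e' j) (q' (j - 1))" if j: "j < Suc (Suc n)" for j
      proof -
        consider "j < n" | "j = n" | "j = Suc n" using j by linarith
        then show ?thesis
        proof cases
          case 3
          have "[:- (2 * Re z), 1:] * ([:0, 1:] * p') - Polynomial.smult (- c) p'
              = ([:- (2 * Re z), 1:] * [:0, 1:] + [:c:]) * p'"
            unfolding distrib_right mult.assoc by simp
          also have "[:- (2 * Re z), 1:] * [:0, 1:] + [:c:] = conj_quadratic z"
            by (simp add: conj_quadratic_def c_def)
          finally show ?thesis using 3 IH(3) unfolding q'_def d'_def e'_def p
            by (simp del: mult_pCons_left)
        qed (use IH(2)[of j] IH(3) IH(5)[of n] in \<open>auto simp: d'_def e'_def q'_def\<close>)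
      qed
      moreover have "{j. j < Suc (Suc n) \<and> e' (Suc j) = 0} = insert (Suc n) {j. j < n \<and> e (Suc j) = 0}"
        using IH(5)[of "Suc (Suc n)"] \<open>e' (Suc n) \<noteq> 0\<close> by (auto simp: e'_def less_Suc_eq)
      then have "card {j. j < Suc (Suc n) \<and> e' (Suc j) = 0} = Suc (card {j. j < n \<and> e (Suc j) = 0})" by simp
      moreover have "num_conjugate_pairs p = Suc (num_conjugate_pairs p')"
        unfolding p using \<open>p' \<noteq> 0\<close> Q num_conjugate_pairs_quadratic[OF 2(1)]
        by (subst num_conjugate_pairs_mult) auto
      moreover have "e' 0 = 0" "\<forall>j\<ge>Suc (Suc n). e' j = 0" using IH(4,5) by (auto simp: e'_def)
      ultimately show ?thesis
        unfolding deg using IH by (intro exI[of _ d'] exI[of _ e'] exI[of _ q']) (auto simp: q'_def)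
    qed
  qed
qed

section \<open>Cyclic vectors\<close>

text \<open>Horner's scheme for the vector q(A) v. It makes the vectors a module over the
  polynomials, with x acting as \<open>A\<close>.\<close>

definition poly_apply :: "'a::comm_ring_1 mat \<Rightarrow> 'a poly \<Rightarrow> 'a vec \<Rightarrow> 'a vec" where
  "poly_apply A q v = fold_coeffs (\<lambda>a w. a \<cdot>\<^sub>v v + A *\<^sub>v w) q (0\<^sub>v (dim_row A))"

definition annihilator_generator :: "'a::comm_ring_1 mat \<Rightarrow> nat \<Rightarrow> 'a vec \<Rightarrow> 'a poly \<Rightarrow> bool" where
  "annihilator_generator A n v m \<longleftrightarrow> (\<forall>q. poly_apply A q v = 0\<^sub>v n \<longleftrightarrow> m dvd q)"

context
  fixes A :: "'a::field mat" and n :: nat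
  assumes A: "A \<in> carrier_mat n n"
begin

lemma poly_apply_0: "poly_apply A 0 v = 0\<^sub>v n"
  using A by (simp add: poly_apply_def)

lemma poly_apply_pCons:
  assumes v: "v \<in> carrier_vec n"
  shows "poly_apply A (pCons a q) v = a \<cdot>\<^sub>v v + A *\<^sub>v poly_apply A q v"
proof (cases "a = 0 \<and> q = 0")
  case True
  have "0 \<cdot>\<^sub>v v + A *\<^sub>v 0\<^sub>v n = 0\<^sub>v n" using A v by (intro eq_vecI) auto
  with True show ?thesis by (simp add: poly_apply_0)
next
  case False
  then show ?thesis by (auto simp: poly_apply_def)
qed

lemma poly_apply_carrier [simp]:
  assumes v: "v \<in> carrier_vec n"
  shows "poly_apply A q v \<in> carrier_vec n"
  by (induction q) (use A v in \<open>auto simp: poly_apply_0 poly_apply_pCons\<close>)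

lemma poly_apply_1: "v \<in> carrier_vec n \<Longrightarrow> poly_apply A 1 v = v"
  unfolding one_pCons using A by (auto simp: poly_apply_0 poly_apply_pCons)

lemma poly_apply_x: "v \<in> carrier_vec n \<Longrightarrow> poly_apply A [:0, 1:] v = A *\<^sub>v v"
proof -
  assume v: "v \<in> carrier_vec n"
  have "[:0, 1:] = pCons 0 (1 :: 'a poly)" by (simp add: one_pCons)
  then have "poly_apply A [:0, 1:] v = 0 \<cdot>\<^sub>v v + A *\<^sub>v v"
    using v by (simp only: poly_apply_pCons poly_apply_1)
  also have "\<dots> = A *\<^sub>v v" using A v by (intro eq_vecI) auto
  finally show ?thesis .
qed

lemma poly_apply_add:
  assumes v: "v \<in> carrier_vec n"
  shows "poly_apply A (p + q) v = poly_apply A p v + poly_apply A q v"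
proof (induction p q rule: poly_induct2)
  case 0
  show ?case by (simp add: poly_apply_0)
next
  case (pCons a p b q)
  let ?P = "poly_apply A p v" and ?Q = "poly_apply A q v"
  have c: "A *\<^sub>v ?P \<in> carrier_vec n" "A *\<^sub>v ?Q \<in> carrier_vec n" using A v by auto
  have "poly_apply A (pCons a p + pCons b q) v = (a \<cdot>\<^sub>v v + b \<cdot>\<^sub>v v) + (A *\<^sub>v ?P + A *\<^sub>v ?Q)"
    using A v pCons by (simp add: poly_apply_pCons add_smult_distrib_vec mult_add_distrib_mat_vec[OF A])
  also have "\<dots> = (a \<cdot>\<^sub>v v + A *\<^sub>v ?P) + (b \<cdot>\<^sub>v v + A *\<^sub>v ?Q)"
    using c v by (intro eq_vecI) auto
  finally show ?case using v by (simp add: poly_apply_pCons)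
qed

lemma poly_apply_smult:
  assumes v: "v \<in> carrier_vec n"
  shows "poly_apply A (Polynomial.smult c p) v = c \<cdot>\<^sub>v poly_apply A p v"
proof (induction p)
  case 0
  show ?case by (auto simp: poly_apply_0)
next
  case (pCons a p)
  let ?P = "poly_apply A p v"
  have P: "?P \<in> carrier_vec n" using v by simp
  then have c: "A *\<^sub>v ?P \<in> carrier_vec n" using A by auto
  have "poly_apply A (Polynomial.smult c (pCons a p)) v = (c * a) \<cdot>\<^sub>v v + c \<cdot>\<^sub>v (A *\<^sub>v ?P)"
    using v pCons by (simp add: poly_apply_pCons mult_mat_vec[OF A P])
  also have "\<dots> = c \<cdot>\<^sub>v (a \<cdot>\<^sub>v v + A *\<^sub>v ?P)"
    using A c v by (intro eq_vecI) (auto simp: algebra_simps)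
  finally show ?case using v by (simp add: poly_apply_pCons)
qed

lemma poly_apply_mult:
  assumes v: "v \<in> carrier_vec n"
  shows "poly_apply A (p * q) v = poly_apply A p (poly_apply A q v)"
proof (induction p)
  case 0
  show ?case by (simp add: poly_apply_0)
next
  case (pCons a p)
  have "0 \<cdot>\<^sub>v v + A *\<^sub>v poly_apply A (p * q) v = A *\<^sub>v poly_apply A (p * q) v"
    using A v by (intro eq_vecI) auto
  then show ?case
    using v pCons by (simp add: poly_apply_pCons poly_apply_add poly_apply_smult)
qed

lemma poly_apply_zero_vec: "poly_apply A q (0\<^sub>v n) = 0\<^sub>v n"
proof (induction q)
  case (pCons a q)
  have "a \<cdot>\<^sub>v 0\<^sub>v n + A *\<^sub>v 0\<^sub>v n = 0\<^sub>v n" using A by (intro eq_vecI) auto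
  with pCons show ?case by (simp add: poly_apply_pCons)
qed (simp add: poly_apply_0)

lemma poly_apply_add_vec:
  assumes v: "v \<in> carrier_vec n" and w: "w \<in> carrier_vec n"
  shows "poly_apply A q (v + w) = poly_apply A q v + poly_apply A q w"
proof (induction q)
  case 0
  show ?case by (simp add: poly_apply_0)
next
  case (pCons a q)
  let ?P = "poly_apply A q v" and ?Q = "poly_apply A q w"
  have c: "A *\<^sub>v ?P \<in> carrier_vec n" "A *\<^sub>v ?Q \<in> carrier_vec n" using A v w by auto
  have "poly_apply A (pCons a q) (v + w) = (a \<cdot>\<^sub>v v + a \<cdot>\<^sub>v w) + (A *\<^sub>v ?P + A *\<^sub>v ?Q)"
    using A v w pCons by (simp add: poly_apply_pCons smult_add_distrib_vec mult_add_distrib_mat_vec[OF A])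
  also have "\<dots> = (a \<cdot>\<^sub>v v + A *\<^sub>v ?P) + (a \<cdot>\<^sub>v w + A *\<^sub>v ?Q)"
    using c v w by (intro eq_vecI) auto
  finally show ?case using v w by (simp add: poly_apply_pCons)
qed

lemma poly_apply_sum_index:
  assumes v: "v \<in> carrier_vec n" and "i < n" and "finite J"
  shows "poly_apply A (\<Sum>j\<in>J. Polynomial.smult (c j) (q j)) v $ i = (\<Sum>j\<in>J. c j * poly_apply A (q j) v $ i)"
  using \<open>finite J\<close>
proof (induction J rule: finite_induct)
  case empty
  show ?case using \<open>i < n\<close> by (simp add: poly_apply_0)
next
  case (insert j J)
  have "dim_vec (poly_apply A (q j) v) = n"
    "dim_vec (poly_apply A (\<Sum>j\<in>J. Polynomial.smult (c j) (q j)) v) = n"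
    by (intro carrier_vecD poly_apply_carrier v)+
  with \<open>i < n\<close> show ?case
    unfolding sum.insert[OF insert.hyps] poly_apply_add[OF v] poly_apply_smult[OF v] insert.IH[symmetric]
    by simp
qed

lemma poly_apply_char_matrix:
  assumes v: "v \<in> carrier_vec n"
  shows "poly_apply A [:- z, 1:] v = char_matrix A z *\<^sub>v v"
proof -
  have "[:- z, 1:] = Polynomial.smult (- z) 1 + [:0, 1:]" by simp
  then have "poly_apply A [:- z, 1:] v = (- z) \<cdot>\<^sub>v v + A *\<^sub>v v"
    using v by (simp only: poly_apply_add poly_apply_smult poly_apply_1 poly_apply_x)
  also have "(- z) \<cdot>\<^sub>v v = ((- z) \<cdot>\<^sub>m 1\<^sub>m n) *\<^sub>v v"
  proof (rule eq_vecI)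
    fix i assume "i < dim_vec (((- z) \<cdot>\<^sub>m 1\<^sub>m n) *\<^sub>v v)"
    then have "i < n" by simp
    then have "(((- z) \<cdot>\<^sub>m 1\<^sub>m n) *\<^sub>v v) $ i = (\<Sum>j<n. - (z * (if j = i then 1 else 0) * v $ j))"
      using v by (simp add: scalar_prod_def atLeast0LessThan)
    also have "\<dots> = (\<Sum>j<n. if j = i then - (z * v $ j) else 0)" by (intro sum.cong) auto
    finally have "(((- z) \<cdot>\<^sub>m 1\<^sub>m n) *\<^sub>v v) $ i = - (z * v $ i)" using \<open>i < n\<close> by simp
    with \<open>i < n\<close> v show "((- z) \<cdot>\<^sub>v v) $ i = (((- z) \<cdot>\<^sub>m 1\<^sub>m n) *\<^sub>v v) $ i" by simp
  qed (use v in simp)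
  also have "\<dots> + A *\<^sub>v v = A *\<^sub>v v + \<dots>"
    using A v by (intro comm_add_vec[of _ n] mult_mat_vec_carrier[of _ n n]) auto
  also have "\<dots> = char_matrix A z *\<^sub>v v"
    unfolding char_matrix_def using A v by (subst add_mult_distrib_mat_vec[of _ n n]) auto
  finally show ?thesis .
qed

text \<open>This connects annihilating polynomials with the kernels of powers of A - z I, whose
  dimensions are read off the Jordan form.\<close>

lemma poly_apply_char_matrix_pow:
  assumes v: "v \<in> carrier_vec n"
  shows "poly_apply A ([:- z, 1:] ^ k) v = (char_matrix A z ^\<^sub>m k) *\<^sub>v v"
  using v
proof (induction k arbitrary: v)
  case 0
  then show ?case using A by (simp add: poly_apply_1 char_matrix_def)
next
  case (Suc k)
  have B: "char_matrix A z \<in> carrier_mat n n" using A by simp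
  then have Bk: "char_matrix A z ^\<^sub>m k \<in> carrier_mat n n" by simp
  have "[:- z, 1:] ^ Suc k = [:- z, 1:] ^ k * [:- z, 1:]" by (simp only: power_Suc2)
  then have "poly_apply A ([:- z, 1:] ^ Suc k) v = poly_apply A ([:- z, 1:] ^ k) (char_matrix A z *\<^sub>v v)"
    using Suc.prems by (simp only: poly_apply_mult poly_apply_char_matrix)
  also have "\<dots> = char_matrix A z ^\<^sub>m k *\<^sub>v (char_matrix A z *\<^sub>v v)"
    using Suc.prems B by (intro Suc.IH) auto
  also have "\<dots> = (char_matrix A z ^\<^sub>m Suc k) *\<^sub>v v"
    using Suc.prems B Bk by (simp add: assoc_mult_mat_vec[of _ n n _ n])
  finally show ?case .
qed

end

text \<open>If q kills v + w, then \<open>m1 * q\<close> kills v and hence also w, so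
  \<open>m2\<close> divides \<open>m1 * q\<close> and by coprimality q. The same holds with the
  roles exchanged.\<close>

lemma annihilator_generator_add:
  fixes A :: "'a::field_gcd mat"
  assumes A: "A \<in> carrier_mat n n" and v: "v \<in> carrier_vec n" and w: "w \<in> carrier_vec n"
    and m1: "annihilator_generator A n v m1" and m2: "annihilator_generator A n w m2"
    and "coprime m1 m2"
  shows "annihilator_generator A n (v + w) (m1 * m2)"
proof -
  note cl = poly_apply_carrier[OF A]
  have iff: "poly_apply A q v = 0\<^sub>v n \<longleftrightarrow> m1 dvd q" "poly_apply A q w = 0\<^sub>v n \<longleftrightarrow> m2 dvd q" for q
    using m1 m2 unfolding annihilator_generator_def by auto
  have sum: "poly_apply A q (v + w) = poly_apply A q v + poly_apply A q w" for q
    by (rule poly_apply_add_vec[OF A v w])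
  have "m1 * m2 dvd q" if q: "poly_apply A q (v + w) = 0\<^sub>v n" for q
  proof -
    have vw: "v + w \<in> carrier_vec n" using v w by simp
    have zero: "poly_apply A (m * q) (v + w) = 0\<^sub>v n" for m
      using q by (simp add: poly_apply_mult[OF A vw] poly_apply_zero_vec[OF A])
    have "poly_apply A (m1 * q) v = 0\<^sub>v n" unfolding iff by simp
    then have "poly_apply A (m1 * q) w = 0\<^sub>v n"
      using zero[of m1] cl[OF w, of "m1 * q"] unfolding sum by simp
    then have "m2 dvd q" using \<open>coprime m1 m2\<close>
      unfolding iff by (simp add: coprime_dvd_mult_right_iff coprime_commute)
    have "poly_apply A (m2 * q) w = 0\<^sub>v n" unfolding iff by simp
    then have "poly_apply A (m2 * q) v = 0\<^sub>v n"
      using zero[of m2] cl[OF v, of "m2 * q"] unfolding sum by simp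
    then have "m1 dvd q" using \<open>coprime m1 m2\<close>
      unfolding iff by (simp add: coprime_dvd_mult_right_iff coprime_commute)
    with \<open>m2 dvd q\<close> \<open>coprime m1 m2\<close> show ?thesis by (simp add: divides_mult)
  qed
  moreover have "poly_apply A q (v + w) = 0\<^sub>v n" if "m1 * m2 dvd q" for q
  proof -
    have "m1 dvd q" "m2 dvd q" using that by (auto dest: dvd_mult_left dvd_mult_right)
    then have "poly_apply A q v = 0\<^sub>v n" "poly_apply A q w = 0\<^sub>v n" unfolding iff by auto
    then show ?thesis unfolding sum by simp
  qed
  ultimately show ?thesis unfolding annihilator_generator_def by blast
qed

text \<open>Suppose q kills w but has order j \<le> k at z, with cofactor r. Multiplying q by the
  missing power of x - z shows that r kills the eigenvector x = (A - z I)^k w. On x, however, r acts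
  as the nonzero scalar r(z).\<close>

lemma annihilator_generator_top_vector:
  fixes A :: "'a::field mat"
  assumes A: "A \<in> carrier_mat n n" and w: "w \<in> carrier_vec n"
    and zero: "poly_apply A ([:- z, 1:] ^ Suc k) w = 0\<^sub>v n"
    and nonzero: "poly_apply A ([:- z, 1:] ^ k) w \<noteq> 0\<^sub>v n"
  shows "annihilator_generator A n w ([:- z, 1:] ^ Suc k)"
  unfolding annihilator_generator_def
proof (intro allI iffI)
  note mult = poly_apply_mult[OF A] and zv = poly_apply_zero_vec[OF A]
  fix q assume "[:- z, 1:] ^ Suc k dvd q"
  then obtain r where "q = [:- z, 1:] ^ Suc k * r" by (elim dvdE)
  then have "q = r * [:- z, 1:] ^ Suc k" by (simp only: mult.commute)
  then show "poly_apply A q w = 0\<^sub>v n" using w zero by (simp only: mult zv)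
next
  note cl = poly_apply_carrier[OF A]
  note mult = poly_apply_mult[OF A] and zv = poly_apply_zero_vec[OF A]
  fix q assume q: "poly_apply A q w = 0\<^sub>v n"
  show "[:- z, 1:] ^ Suc k dvd q"
  proof (rule ccontr)
    assume ndvd: "\<not> [:- z, 1:] ^ Suc k dvd q"
    then have "q \<noteq> 0" by auto
    define j where "j = Polynomial.order z q"
    have "j \<le> k" using ndvd unfolding j_def order_divides by simp
    obtain r where r: "q = [:- z, 1:] ^ j * r" "\<not> [:- z, 1:] dvd r"
      using order_decomp[OF \<open>q \<noteq> 0\<close>, of z] unfolding j_def by blast
    define x where "x = poly_apply A ([:- z, 1:] ^ k) w"
    have x: "x \<in> carrier_vec n" unfolding x_def using w by (rule cl)
    have "poly_apply A ([:- z, 1:] * [:- z, 1:] ^ k) w = 0\<^sub>v n" using zero by (simp only: power_Suc)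
    then have x0: "poly_apply A [:- z, 1:] x = 0\<^sub>v n" using w unfolding x_def by (simp only: mult)
    have "r * [:- z, 1:] ^ k = [:- z, 1:] ^ (k - j) * q"
      using \<open>j \<le> k\<close> unfolding r(1) mult.assoc[symmetric] power_add[symmetric]
      by (simp only: le_add_diff_inverse2 mult.commute)
    then have "poly_apply A (r * [:- z, 1:] ^ k) w = 0\<^sub>v n" using w q by (simp only: mult zv)
    then have rx: "poly_apply A r x = 0\<^sub>v n" using w unfolding x_def by (simp only: mult)
    have "[:- z, 1:] * synthetic_div r z + [:poly r z:] = r" by (rule synthetic_div_correct')
    then have *: "Polynomial.smult (poly r z) 1 = r + (- synthetic_div r z) * [:- z, 1:]"
      by (simp add: algebra_simps del: mult_pCons_left mult_pCons_right)
    have "poly_apply A (Polynomial.smult (poly r z) 1) x = 0\<^sub>v n"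
      unfolding * using x by (simp only: poly_apply_add[OF A] mult rx x0 zv) simp
    then have "poly r z \<cdot>\<^sub>v x = 0\<^sub>v n"
      using x by (simp only: poly_apply_smult[OF A] poly_apply_1[OF A])
    moreover have "poly r z \<noteq> 0" using r(2) by (simp add: poly_eq_0_iff_dvd)
    ultimately have "x $ i = 0" if "i < n" for i
    proof -
      have "(poly r z \<cdot>\<^sub>v x) $ i = 0" using \<open>poly r z \<cdot>\<^sub>v x = 0\<^sub>v n\<close> that by simp
      with \<open>poly r z \<noteq> 0\<close> x that show ?thesis by simp
    qed
    then have "x = 0\<^sub>v n" using x by (intro eq_vecI) auto
    with nonzero show False unfolding x_def by simp
  qed
qed

section \<open>Cyclic tridiagonal matrices\<close>

text \<open>The subdiagonal links \<open>l\<close> and the corner \<open>c\<close> form the cycle;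
  \<open>e\<close> is indexed by its column, so \<open>e 0\<close> does not occur. The entries are
  added up because the corner falls on the diagonal for n = 1 and on the superdiagonal for n =
  2.\<close>

definition cyclic_tridiagonal ::
  "nat \<Rightarrow> (nat \<Rightarrow> 'a::comm_ring_1) \<Rightarrow> (nat \<Rightarrow> 'a) \<Rightarrow> (nat \<Rightarrow> 'a) \<Rightarrow> 'a \<Rightarrow> 'a mat" where
  "cyclic_tridiagonal n d e l c = mat n n (\<lambda>(i, j).
     (if i = j then d i else 0) + (if i = Suc j then l j else 0)
   + (if Suc i = j then e j else 0) + (if i = 0 \<and> j = n - 1 then c else 0))"

lemma cyclic_tridiagonal_carrier [simp]: "cyclic_tridiagonal n d e l c \<in> carrier_mat n n"
  by (simp add: cyclic_tridiagonal_def)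

text \<open>Left multiplication by the vector of the \<open>q j * (\<Prod>k\<in>{j..<n - 1}. l k)\<close> clears the first row
  except for its last entry.\<close>

lemma det_cyclic_tridiagonal:
  fixes s c :: "'a::idom"
  assumes "n \<ge> 1" and q0: "q 0 = 1" and "e 0 = 0"
    and q: "\<And>j. j < n \<Longrightarrow> q (Suc j) = (s - d j) * q j - e j * q (j - 1)"
    and el: "\<And>j. e (Suc j) * l j = e (Suc j)"
    and L: "(\<Prod>j<n - 1. l j) \<noteq> 0"
  shows "det (s \<cdot>\<^sub>m 1\<^sub>m n - cyclic_tridiagonal n d e l c) = q n - c * (\<Prod>j<n - 1. l j)"
proof -
  define T where "T = s \<cdot>\<^sub>m 1\<^sub>m n - cyclic_tridiagonal n d e l c"
  have T: "T \<in> carrier_mat n n" unfolding T_def by (intro minus_carrier_mat) simp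
  have T_index: "T $$ (i, j) = (if i = j then s - d i else 0) - (if i = Suc j then l j else 0)
      - (if Suc i = j then e j else 0) - (if i = 0 \<and> j = n - 1 then c else 0)"
    if "i < n" "j < n" for i j
    using that by (simp add: T_def cyclic_tridiagonal_def)
  define L where "L i = (\<Prod>j\<in>{i..<n - 1}. l j)" for i
  have L_step: "L i = l i * L (Suc i)" if "i < n - 1" for i
    using that by (simp add: L_def prod.atLeast_Suc_lessThan)
  have L_last: "L (n - 1) = 1" by (simp add: L_def)
  have L0: "L 0 = (\<Prod>j<n - 1. l j)" by (simp add: L_def atLeast0LessThan)
  define y where "y i = q i * L i" for i
  define Y where "Y = mat n n (\<lambda>(i, j). if i = 0 then y j else if i = j then 1 else 0)"
  have Y: "Y \<in> carrier_mat n n" by (simp add: Y_def)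
  have "det Y = prod_list (diag_mat Y)"
    by (rule det_upper_triangular[OF _ Y]) (auto simp: Y_def)
  also have "\<dots> = (\<Prod>i<n. if i = 0 then y 0 else 1)"
    unfolding prod_list_diag_prod using Y by (intro prod.cong) (auto simp: Y_def)
  also have "\<dots> = L 0" using \<open>n \<ge> 1\<close> by (simp add: y_def q0)
  finally have det_Y: "det Y = L 0" .
  \<comment> \<open>The three terms of column j are those of the recurrence. They cancel in every
    column but the last, where no row below supplies \<open>q n\<close>.\<close>
  have row0: "(\<Sum>i<n. y i * T $$ (i, j)) = (if j = n - 1 then q n - c * L 0 else 0)" if j: "j < n" for j
  proof -
    have "(\<Sum>i<n. y i * T $$ (i, j)) = (\<Sum>i<n. (if i = j then y j * (s - d j) else 0)
        - (if i = Suc j then y (Suc j) * l j else 0) - (if i = j - 1 \<and> j > 0 then y (j - 1) * e j else 0)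
        - (if i = 0 then if j = n - 1 then y 0 * c else 0 else 0))"
      using j by (intro sum.cong) (auto simp: T_index algebra_simps)
    also have "\<dots> = y j * (s - d j) - (if Suc j < n then y (Suc j) * l j else 0)
        - (if j > 0 then y (j - 1) * e j else 0) - (if j = n - 1 then y 0 * c else 0)"
      using j \<open>n \<ge> 1\<close> by (cases "j = 0") (auto simp: sum_subtractf)
    \<comment> \<open>The weight of row j - 1 carries the extra link \<open>l (j - 1)\<close>, which
      disappears because the link equals 1 wherever \<open>e j\<close> is nonzero.\<close>
    also have "(if j > 0 then y (j - 1) * e j else 0) = L j * (e j * q (j - 1))"
    proof (cases j)
      case (Suc i)
      then have "L i = l i * L j" using L_step[of i] j by simp
      then have "y i * e j = L j * ((e (Suc i) * l i) * q i)" using Suc by (simp add: y_def)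
      then show ?thesis using Suc unfolding el by simp
    qed (use \<open>e 0 = 0\<close> in simp)
    also have "(if Suc j < n then y (Suc j) * l j else 0) = (if j = n - 1 then 0 else L j * q (Suc j))"
      using L_step[of j] j by (auto simp: y_def)
    finally have eq: "(\<Sum>i<n. y i * T $$ (i, j)) = L j * ((s - d j) * q j - e j * q (j - 1))
        - (if j = n - 1 then 0 else L j * q (Suc j)) - (if j = n - 1 then y 0 * c else 0)"
      by (simp add: y_def algebra_simps)
    then show ?thesis
      using q[OF j] L_last \<open>n \<ge> 1\<close> by (auto simp: y_def q0 simp flip: q)
  qed
  have YT: "Y * T \<in> carrier_mat n n" using Y T by simp
  have YT_0: "(Y * T) $$ (0, j) = (if j = n - 1 then q n - c * L 0 else 0)" if "j < n" for j
    using that \<open>n \<ge> 1\<close> T row0[OF that]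
    by (simp add: Y_def scalar_prod_def atLeast0LessThan)
  have YT_Suc: "(Y * T) $$ (i, j) = T $$ (i, j)" if "i < n" "j < n" "i > 0" for i j
  proof -
    have "(Y * T) $$ (i, j) = (\<Sum>k<n. (if i = k then 1 else 0) * T $$ (k, j))"
      using that T by (simp add: Y_def scalar_prod_def atLeast0LessThan)
    also have "\<dots> = (\<Sum>k<n. if k = i then T $$ (k, j) else 0)" by (intro sum.cong) auto
    also have "\<dots> = T $$ (i, j)" using that by simp
    finally show ?thesis .
  qed
  \<comment> \<open>The only cofactor left in the expansion along row 0. Deleting that row and the
    last column moves the links onto the diagonal of an upper triangular matrix.\<close>
  define D where "D = mat_delete (Y * T) 0 (n - 1)"
  have D: "D \<in> carrier_mat (n - 1) (n - 1)" unfolding D_def by (rule mat_delete_carrier[OF YT])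
  have D_index: "D $$ (i, j) = T $$ (Suc i, j)" if "i < n - 1" "j < n - 1" for i j
    using that Y T YT_Suc[of "Suc i" j] by (auto simp: D_def mat_delete_def)
  have "det D = prod_list (diag_mat D)"
    by (rule det_upper_triangular[OF _ D]) (use D in \<open>auto simp: D_index T_index\<close>)
  also have "\<dots> = (\<Prod>i<n - 1. - l i)"
    unfolding prod_list_diag_prod using D
    by (auto simp: D_index T_index atLeast0LessThan intro!: prod.cong)
  also have "\<dots> = (- 1) ^ (n - 1) * L 0"
    unfolding L0 by (simp add: prod_uminus)
  finally have det_D: "det D = (- 1) ^ (n - 1) * L 0" .
  have "L 0 * det T = det (Y * T)" unfolding det_mult[OF Y T] det_Y ..
  also have "\<dots> = (\<Sum>j<n. (Y * T) $$ (0, j) * cofactor (Y * T) 0 j)"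
    using laplace_expansion_row[OF YT, of 0] \<open>n \<ge> 1\<close> by simp
  also have "\<dots> = (\<Sum>j<n. if j = n - 1 then (q n - c * L 0) * cofactor (Y * T) 0 (n - 1) else 0)"
    by (intro sum.cong) (auto simp: YT_0)
  also have "\<dots> = (q n - c * L 0) * ((- 1) ^ (n - 1) * det D)"
    using \<open>n \<ge> 1\<close> by (simp add: cofactor_def D_def)
  also have "\<dots> = L 0 * (q n - c * L 0)"
    unfolding det_D by (simp add: algebra_simps flip: power_add mult_2)
  finally show ?thesis using L unfolding L0 T_def by simp
qed

lemma poly_char_poly_det:
  fixes A :: "'a::comm_ring_1 mat"
  assumes "A \<in> carrier_mat n n"
  shows "poly (char_poly A) s = det (s \<cdot>\<^sub>m 1\<^sub>m n - A)"
proof -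
  have "map_mat (\<lambda>p. poly p s) (char_poly_matrix A) = s \<cdot>\<^sub>m 1\<^sub>m n - A"
    using assms by (intro eq_matI) (auto simp: char_poly_matrix_def)
  then show ?thesis
    unfolding char_poly_def comm_ring_hom.hom_det[OF poly_hom.comm_ring_hom_axioms, symmetric] by simp
qed

text \<open>The link weights are treated as polynomials in \<open>x\<close>, so that they can be cancelled even at
  parameter values where some link vanishes.\<close>

lemma char_poly_cyclic_tridiagonal:
  fixes q :: "nat \<Rightarrow> real poly"
  assumes "n \<ge> 1" and q0: "q 0 = 1" and "e 0 = 0"
    and q: "\<And>j. j < n \<Longrightarrow> q (Suc j) = [:- d j, 1:] * q j - Polynomial.smult (e j) (q (j - 1))"
    and ek: "\<And>j. e (Suc j) * k j = 0"
  shows "char_poly (cyclic_tridiagonal n d e (\<lambda>j. 1 + k j * x) (- b * (1 + k (n - 1) * x)))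
       = q n + [:b * (\<Prod>j<n. 1 + k j * x):]"
proof -
  define N where "N = cyclic_tridiagonal n d e (\<lambda>j. 1 + k j * x) (- b * (1 + k (n - 1) * x))"
  have "poly (char_poly N) s = poly (q n + [:b * (\<Prod>j<n. 1 + k j * x):]) s" for s
  proof -
    \<comment> \<open>The polynomial variable stands for the parameter \<open>x\<close>. Each link
      has constant term 1, so the product of the links is a nonzero polynomial.\<close>
    define l where "l j = [:1, k j:]" for j
    define T where "T = [:s:] \<cdot>\<^sub>m 1\<^sub>m n
      - cyclic_tridiagonal n (\<lambda>j. [:d j:]) (\<lambda>j. [:e j:]) l (- ([:b:] * l (n - 1)))"
    have "map_mat (\<lambda>p. poly p x) T = s \<cdot>\<^sub>m 1\<^sub>m n - N"
      by (intro eq_matI) (auto simp: T_def N_def cyclic_tridiagonal_def l_def algebra_simps)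
    then have "poly (char_poly N) s = poly (det T) x"
      unfolding comm_ring_hom.hom_det[OF poly_hom.comm_ring_hom_axioms, symmetric] by (subst poly_char_poly_det) (auto simp: N_def)
    also have "det T = [:poly (q n) s:] - - ([:b:] * l (n - 1)) * (\<Prod>j<n - 1. l j)"
      unfolding T_def
    proof (rule det_cyclic_tridiagonal)
      show "[:poly (q (Suc j)) s:] = ([:s:] - [:d j:]) * [:poly (q j) s:] - [:e j:] * [:poly (q (j - 1)) s:]"
        if "j < n" for j
        unfolding q[OF that] by (simp add: algebra_simps)
      show "[:e (Suc j):] * l j = [:e (Suc j):]" for j using ek[of j] by (auto simp: l_def)
      show "(\<Prod>j<n - 1. l j) \<noteq> 0" by (simp add: l_def)
    qed (use assms in auto)
    also have "poly \<dots> x = poly (q n) s + b * ((\<Prod>j<n - 1. 1 + k j * x) * (1 + k (n - 1) * x))"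
      by (simp add: l_def poly_prod algebra_simps)
    \<comment> \<open>The corner supplies the missing link with index n - 1.\<close>
    also have "(\<Prod>j<n - 1. 1 + k j * x) * (1 + k (n - 1) * x) = (\<Prod>j<n. 1 + k j * x)"
      using \<open>n \<ge> 1\<close> by (cases n) auto
    finally show ?thesis by simp
  qed
  then show ?thesis unfolding N_def by (simp add: poly_eq_poly_eq_iff[symmetric] fun_eq_iff)
qed

section \<open>Cyclic bases\<close>

lemma filter_distinct_snd:
  assumes "distinct (map snd xs)" "(k, z) \<in> set xs"
  shows "[(n, e) \<leftarrow> xs. e = z] = [(k, z)]"
  using assms
proof (induction xs)
  case (Cons x xs)
  show ?case
  proof (cases "snd x = z")
    case True
    then have "z \<notin> set (map snd xs)" using Cons.prems by auto
    then have "[(n, e) \<leftarrow> xs. e = z] = []" and "(k, z) \<notin> set xs"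
      by (force simp: filter_empty_conv)+
    with Cons.prems True show ?thesis by auto
  next
    case False
    with Cons show ?thesis by auto
  qed
qed simp

lemma kernel_dim_cong:
  fixes A B :: "'a::field mat"
  assumes "A \<in> carrier_mat n n" "B \<in> carrier_mat n n" "mat_kernel A = mat_kernel B"
  shows "kernel_dim A = kernel_dim B"
  using assms by (simp add: kernel_dim_def)

text \<open>With a single block of size k for z, the kernel of (A - z I)^m has dimension
  \<open>min m k\<close>. It still grows from m = k - 1 to m = k, and any vector gained there
  works.\<close>

lemma exists_annihilator_generator_block:
  fixes A :: "'a::field mat"
  assumes A: "A \<in> carrier_mat n n" and jnf: "jordan_nf A blocks" and dist: "distinct (map snd blocks)"
    and kz: "(k, z) \<in> set blocks"
  shows "\<exists>w\<in>carrier_vec n. annihilator_generator A n w ([:- z, 1:] ^ k)"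
proof -
  have "k \<noteq> 0" using jnf kz by (force simp: jordan_nf_def)
  then obtain k' where k: "k = Suc k'" by (cases k) auto
  define B where "B = char_matrix A z"
  have B: "B ^\<^sub>m m \<in> carrier_mat n n" for m using A by (simp add: B_def)
  have "kernel_dim (B ^\<^sub>m m) = min m k" for m
    using dim_gen_eigenspace[OF jnf, of z m] filter_distinct_snd[OF dist kz]
    by (simp add: dim_gen_eigenspace_def B_def)
  then have "kernel_dim (B ^\<^sub>m Suc k') \<noteq> kernel_dim (B ^\<^sub>m k')" by (simp add: k del: pow_mat.simps)
  then have "mat_kernel (B ^\<^sub>m Suc k') \<noteq> mat_kernel (B ^\<^sub>m k')" using kernel_dim_cong[OF B B] by blast
  moreover have "mat_kernel (B ^\<^sub>m k') \<subseteq> mat_kernel (B ^\<^sub>m Suc k')"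
  proof
    fix w assume "w \<in> mat_kernel (B ^\<^sub>m k')"
    then have w: "w \<in> carrier_vec n" "B ^\<^sub>m k' *\<^sub>v w = 0\<^sub>v n" using mat_kernelD[OF B] by auto
    have "poly_apply A ([:- z, 1:] ^ k') w = 0\<^sub>v n"
      unfolding poly_apply_char_matrix_pow[OF A w(1)] using w by (simp add: B_def)
    then have "poly_apply A ([:- z, 1:] * [:- z, 1:] ^ k') w = 0\<^sub>v n"
      unfolding poly_apply_mult[OF A w(1)] by (simp only: poly_apply_zero_vec[OF A])
    then have "B ^\<^sub>m Suc k' *\<^sub>v w = 0\<^sub>v n"
      unfolding power_Suc[symmetric] poly_apply_char_matrix_pow[OF A w(1)] B_def .
    with w(1) show "w \<in> mat_kernel (B ^\<^sub>m Suc k')" by (intro mat_kernelI[OF B])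
  qed
  ultimately obtain w where "w \<in> mat_kernel (B ^\<^sub>m Suc k')" "w \<notin> mat_kernel (B ^\<^sub>m k')" by blast
  then have w: "w \<in> carrier_vec n" "B ^\<^sub>m Suc k' *\<^sub>v w = 0\<^sub>v n" "B ^\<^sub>m k' *\<^sub>v w \<noteq> 0\<^sub>v n"
    using mat_kernelD[OF B, of w "Suc k'"] mat_kernelI[OF B, of w k'] by blast+
  then have "poly_apply A ([:- z, 1:] ^ Suc k') w = 0\<^sub>v n" "poly_apply A ([:- z, 1:] ^ k') w \<noteq> 0\<^sub>v n"
    unfolding poly_apply_char_matrix_pow[OF A w(1)] B_def by blast+
  then have "annihilator_generator A n w ([:- z, 1:] ^ Suc k')"
    by (rule annihilator_generator_top_vector[OF A w(1)])
  with w(1) show ?thesis unfolding k by blast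
qed

lemma coprime_linear_powers:
  fixes z :: "'a::field_gcd"
  assumes "z \<noteq> w"
  shows "coprime ([:- z, 1:] ^ j) ([:- w, 1:] ^ k)"
proof -
  have "coprime [:- z, 1:] [:- w, 1:]"
  proof (rule coprimeI)
    fix d assume d: "d dvd [:- z, 1:]" "d dvd [:- w, 1:]"
    then have "d dvd [:- z, 1:] - [:- w, 1:]" by (rule dvd_diff)
    then have "d dvd [:w - z:]" by simp
    moreover have "is_unit [:w - z:]" using assms by (simp add: is_unit_const_poly_iff)
    ultimately show "is_unit d" by (rule dvd_trans)
  qed
  then show ?thesis by simp
qed

text \<open>The sum of one such vector per block is a cyclic vector, because powers of x - z for
  distinct z are coprime.\<close>

lemma exists_annihilator_generator_char_poly:
  fixes A :: "'a::field_gcd mat"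
  assumes A: "A \<in> carrier_mat n n" and jnf: "jordan_nf A blocks" and dist: "distinct (map snd blocks)"
  shows "\<exists>v\<in>carrier_vec n. annihilator_generator A n v (char_poly A)"
proof -
  have "\<exists>v\<in>carrier_vec n. annihilator_generator A n v (\<Prod>(k, z)\<leftarrow>bs. [:- z, 1:] ^ k)"
    if "set bs \<subseteq> set blocks" "distinct (map snd bs)" for bs
    using that
  proof (induction bs)
    case Nil
    show ?case
      by (intro bexI[of _ "0\<^sub>v n"]) (auto simp: annihilator_generator_def poly_apply_zero_vec[OF A])
  next
    case (Cons b bs)
    obtain k z where b: "b = (k, z)" by (cases b)
    from Cons obtain v where v: "v \<in> carrier_vec n" "annihilator_generator A n v (\<Prod>(k, z)\<leftarrow>bs. [:- z, 1:] ^ k)"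
      by auto
    obtain w where w: "w \<in> carrier_vec n" "annihilator_generator A n w ([:- z, 1:] ^ k)"
      using exists_annihilator_generator_block[OF A jnf dist, of k z] Cons.prems b by auto
    have "coprime ([:- z, 1:] ^ k) (\<Prod>(k, z)\<leftarrow>bs. [:- z, 1:] ^ k)"
      using Cons.prems(2) unfolding b
    proof (induction bs)
      case (Cons c bs)
      obtain m y where c: "c = (m, y)" by (cases c)
      with Cons.prems have "coprime ([:- z, 1:] ^ k) ([:- y, 1:] ^ m)"
        by (intro coprime_linear_powers) auto
      moreover have "coprime ([:- z, 1:] ^ k) (\<Prod>(k, z)\<leftarrow>bs. [:- z, 1:] ^ k)"
        using Cons by simp
      ultimately show ?case unfolding c by (simp only: list.map prod_list.Cons prod.case coprime_mult_right_iff)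
    qed simp
    from annihilator_generator_add[OF A w(1) v(1) w(2) v(2) this] v w show ?case
      unfolding b by (intro bexI[of _ "w + v"]) auto
  qed
  from this[of blocks] dist show ?thesis by (simp add: jordan_nf_char_poly[OF jnf])
qed

section \<open>Bases adapted to a three-term recurrence\<close>

lemma three_term_recurrence_degree:
  fixes q :: "nat \<Rightarrow> 'a::field poly"
  assumes q0: "q 0 = 1" and q: "\<And>j. j < n \<Longrightarrow> q (Suc j) = [:- d j, 1:] * q j - Polynomial.smult (e j) (q (j - 1))"
    and "e 0 = 0" "j \<le> n"
  shows "monic (q j) \<and> degree (q j) = j"
  using \<open>j \<le> n\<close>
proof (induction j rule: less_induct)
  case (less j)
  show ?case
  proof (cases j)
    case (Suc i)
    have "i < j" "i \<le> n" using less.prems Suc by auto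
    then have IH: "monic (q i)" "degree (q i) = i" using less.IH[of i] by blast+
    then have "q i \<noteq> 0" by force
    then have deg: "degree ([:- d i, 1:] * q i) = Suc i"
      using IH by (subst degree_mult_eq) auto
    define r where "r = Polynomial.smult (- e i) (q (i - 1))"
    have "degree r < Suc i"
    proof (cases i)
      case (Suc i')
      then have "degree (q i') = i'" using less.IH[of i'] less.prems \<open>j = Suc i\<close> by auto
      then show ?thesis using Suc unfolding r_def by (simp add: le_imp_less_Suc degree_smult_le le_SucI)
    qed (use \<open>e 0 = 0\<close> in \<open>simp add: r_def\<close>)
    moreover have "q j = [:- d i, 1:] * q i + r"
      using q[of i] less.prems Suc by (simp add: r_def del: mult_pCons_left)
    ultimately have "degree (q j) = Suc i \<and> lead_coeff (q j) = lead_coeff ([:- d i, 1:] * q i)"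
      using deg by (simp add: degree_add_eq_left coeff_eq_0 del: mult_pCons_left)
    moreover have "lead_coeff ([:- d i, 1:] * q i) = 1"
      unfolding lead_coeff_mult using IH by simp
    ultimately show ?thesis using Suc by metis
  qed (simp add: q0)
qed

lemma monic_family_independent:
  fixes q :: "nat \<Rightarrow> 'a::field poly"
  assumes q: "\<And>j. j < n \<Longrightarrow> monic (q j) \<and> degree (q j) = j"
    and sum: "(\<Sum>j<n. Polynomial.smult (c j) (q j)) = 0" and "j < n"
  shows "c j = 0"
  using q sum \<open>j < n\<close>
proof (induction n)
  case (Suc n)
  have "coeff (\<Sum>j<Suc n. Polynomial.smult (c j) (q j)) n = (\<Sum>j<n. c j * coeff (q j) n) + c n * coeff (q n) n"
    by (simp add: coeff_sum)
  also have "(\<Sum>j<n. c j * coeff (q j) n) = 0"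
    using Suc.prems(1) by (intro sum.neutral) (simp add: coeff_eq_0)
  also have "coeff (q n) n = 1" using Suc.prems(1)[of n] by (metis lessI)
  finally have "c n = 0" unfolding Suc.prems(2) by simp
  then have "(\<Sum>j<n. Polynomial.smult (c j) (q j)) = 0" using Suc.prems(2) by simp
  with Suc.IH Suc.prems(1) have "j < n \<Longrightarrow> c j = 0" by (meson less_SucI)
  with \<open>c n = 0\<close> Suc.prems(3) show ?case by (auto simp: less_Suc_eq)
qed simp

text \<open>The columns of \<open>W\<close> are the vectors q_j(A) v. A linear relation between them
  would be a nonzero polynomial of degree below n killing v, and the recurrence describes how
  \<open>A\<close> acts on them.\<close>

lemma exists_cyclic_basis:
  fixes A :: "'a::field mat"
  assumes A: "A \<in> carrier_mat n n" and "n \<ge> 1"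
    and v: "v \<in> carrier_vec n" and ann: "annihilator_generator A n v f" and "degree f = n"
    and q0: "q 0 = 1" and q: "\<And>j. j < n \<Longrightarrow> q (Suc j) = [:- d j, 1:] * q j - Polynomial.smult (e j) (q (j - 1))"
    and "e 0 = 0" and qn: "q n = f - [:b:]"
  shows "\<exists>W\<in>carrier_mat n n. det W \<noteq> 0 \<and> A * W = W * cyclic_tridiagonal n d e (\<lambda>_. 1) (- b)"
proof -
  define W where "W = mat n n (\<lambda>(i, j). poly_apply A (q j) v $ i)"
  define M where "M = cyclic_tridiagonal n d e (\<lambda>_. 1) (- b)"
  have W: "W \<in> carrier_mat n n" by (simp add: W_def)
  have M: "M \<in> carrier_mat n n" by (simp add: M_def)
  note cl = poly_apply_carrier[OF A v]
  have iff: "poly_apply A r v = 0\<^sub>v n \<longleftrightarrow> f dvd r" for r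
    using ann by (simp add: annihilator_generator_def)
  have deg: "monic (q j) \<and> degree (q j) = j" if "j < n" for j
    by (rule three_term_recurrence_degree[where q = q and n = n, OF q0 q \<open>e 0 = 0\<close>]) (use that in simp_all)
  have "det W \<noteq> 0"
  proof
    assume "det W = 0"
    then obtain c where c: "c \<in> carrier_vec n" "c \<noteq> 0\<^sub>v n" "W *\<^sub>v c = 0\<^sub>v n"
      using det_0_iff_vec_prod_zero_field[OF W] by blast
    define r where "r = (\<Sum>j<n. Polynomial.smult (c $ j) (q j))"
    have "poly_apply A r v = 0\<^sub>v n"
    proof (rule eq_vecI)
      fix i assume "i < dim_vec (0\<^sub>v n :: 'a vec)"
      then have i: "i < n" by simp
      have "poly_apply A r v $ i = (\<Sum>j<n. c $ j * poly_apply A (q j) v $ i)"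
        unfolding r_def using i by (intro poly_apply_sum_index[OF A v]) auto
      also have "\<dots> = (W *\<^sub>v c) $ i"
        using i c(1) by (simp add: W_def scalar_prod_def atLeast0LessThan mult.commute)
      finally show "poly_apply A r v $ i = 0\<^sub>v n $ i" using c(3) by simp
    qed (use cl in \<open>simp add: carrier_vecD\<close>)
    then have "f dvd r" by (simp add: iff)
    moreover have "degree r < n"
    proof -
      have "degree r \<le> n - 1"
        unfolding r_def using deg by (intro degree_sum_le) (auto intro!: order_trans[OF degree_smult_le])
      then show ?thesis using \<open>n \<ge> 1\<close> by linarith
    qed
    ultimately have "r = 0" using \<open>degree f = n\<close> by (metis dvd_imp_degree_le leD)
    then have "c $ j = 0" if "j < n" for j
      using monic_family_independent[OF deg, of n "\<lambda>j. c $ j" j] that unfolding r_def by blast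
    then have "c = 0\<^sub>v n" using c(1) by (intro eq_vecI) auto
    with c(2) show False by simp
  qed
  moreover have "A * W = W * M"
  proof (rule eq_matI)
    fix i j assume "i < dim_row (W * M)" "j < dim_col (W * M)"
    then have i: "i < n" and j: "j < n" using W M by auto
    define u where "u j = poly_apply A (q j) v $ i" for j
    have "col W j = poly_apply A (q j) v"
      using j cl[of "q j"] by (intro eq_vecI) (auto simp: W_def)
    then have "(A * W) $$ (i, j) = (A *\<^sub>v poly_apply A (q j) v) $ i" using A W i j by simp
    also have "A *\<^sub>v poly_apply A (q j) v = poly_apply A ([:0, 1:] * q j) v"
      unfolding poly_apply_mult[OF A v] by (rule poly_apply_x[OF A cl, symmetric])
    also have "[:0, 1:] * q j = q (Suc j) + Polynomial.smult (d j) (q j) + Polynomial.smult (e j) (q (j - 1))"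
      unfolding q[OF j] by (simp add: algebra_simps)
    also have "poly_apply A \<dots> v $ i = u (Suc j) + d j * u j + e j * u (j - 1)"
      using i carrier_vecD[OF cl] unfolding u_def
      by (simp add: poly_apply_add[OF A v] poly_apply_smult[OF A v])
    \<comment> \<open>In the last column \<open>q n = f - b\<close>, and f kills v, so
      multiplication by \<open>A\<close> leads back to \<open>- b\<close> times the first basis
      vector: the corner entry.\<close>
    also have "u (Suc j) = (if Suc j < n then u (Suc j) else - b * u 0)"
    proof (cases "Suc j < n")
      case False
      then have "Suc j = n" using j by simp
      have "q n = f + Polynomial.smult (- b) (q 0)" unfolding qn q0 by simp
      then have "poly_apply A (q n) v = 0\<^sub>v n + (- b) \<cdot>\<^sub>v poly_apply A (q 0) v"
        using iff[of f] by (simp only: poly_apply_add[OF A v] poly_apply_smult[OF A v]) simp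
      then show ?thesis using \<open>Suc j = n\<close> i carrier_vecD[OF cl] by (simp add: u_def)
    qed simp
    finally have AW: "(A * W) $$ (i, j) = (if Suc j < n then u (Suc j) else - b * u 0) + d j * u j + e j * u (j - 1)" .
    have "(W * M) $$ (i, j) = (\<Sum>k<n. u k * M $$ (k, j))"
      using i j W M by (simp add: scalar_prod_def atLeast0LessThan W_def u_def)
    also have "\<dots> = (\<Sum>k<n. (if k = j then d j * u j else 0) + (if k = Suc j then u (Suc j) else 0)
        + (if k = j - 1 \<and> j > 0 then e j * u (j - 1) else 0) + (if k = 0 then if j = n - 1 then - b * u 0 else 0 else 0))"
      using j by (intro sum.cong) (auto simp: M_def cyclic_tridiagonal_def algebra_simps)
    also have "\<dots> = d j * u j + (if Suc j < n then u (Suc j) else 0) + e j * u (j - 1)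
        + (if j = n - 1 then - b * u 0 else 0)"
      using j \<open>e 0 = 0\<close> by (cases "j = 0") (auto simp: sum.distrib)
    also have "\<dots> = (A * W) $$ (i, j)" unfolding AW using j by auto
    finally show "(A * W) $$ (i, j) = (W * M) $$ (i, j)" ..
  qed (use A W M in auto)
  ultimately show ?thesis using W unfolding M_def by blast
qed

text \<open>For an intertwiner \<open>X + \<i> Y\<close>, the polynomial \<open>det (X + t Y)\<close> is nonzero at \<open>t = \<i>\<close> and hence
  at some real \<open>t\<close>.\<close>

lemma real_intertwiner:
  fixes F M :: "real mat" and W :: "complex mat"
  assumes F: "F \<in> carrier_mat n n" and M: "M \<in> carrier_mat n n" and W: "W \<in> carrier_mat n n"
    and "det W \<noteq> 0" and FW: "map_mat complex_of_real F * W = W * map_mat complex_of_real M"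
  shows "\<exists>V\<in>carrier_mat n n. det V \<noteq> 0 \<and> F * V = V * M"
proof -
  define P where "P = mat n n (\<lambda>(i, j). [:Re (W $$ (i, j)), Im (W $$ (i, j)):])"
  have P: "P \<in> carrier_mat n n" by (simp add: P_def)
  have "map_mat cpoly P \<in> carrier_mat n n" using P by simp
  then have "poly (det (map_mat cpoly P)) \<i> = det W"
    by (rule poly_det_cong[OF W]) (auto simp: P_def hom_distribs complex_eq_iff)
  then have "cpoly (det P) \<noteq> 0" using \<open>det W \<noteq> 0\<close> unfolding cpoly_hom.hom_det by auto
  then have "det P \<noteq> 0" by auto
  then have "finite {t. poly (det P) t = 0}" by (rule poly_roots_finite)
  then obtain t where t: "poly (det P) t \<noteq> 0"
    using ex_new_if_finite[OF infinite_UNIV_char_0] by blast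
  define V where "V = mat n n (\<lambda>(i, j). Re (W $$ (i, j)) + t * Im (W $$ (i, j)))"
  have V: "V \<in> carrier_mat n n" by (simp add: V_def)
  have "poly (det P) t = det V"
    by (rule poly_det_cong[OF V P]) (auto simp: P_def V_def)
  with t have "det V \<noteq> 0" by simp
  moreover have "F * V = V * M"
  proof (rule eq_matI)
    fix i j assume "i < dim_row (V * M)" "j < dim_col (V * M)"
    then have i: "i < n" and j: "j < n" using V M by auto
    have "(map_mat complex_of_real F * W) $$ (i, j) = (W * map_mat complex_of_real M) $$ (i, j)"
      using FW by simp
    then have eq: "(\<Sum>k<n. complex_of_real (F $$ (i, k)) * W $$ (k, j)) = (\<Sum>k<n. W $$ (i, k) * complex_of_real (M $$ (k, j)))"
      using i j F W M by (simp add: scalar_prod_def atLeast0LessThan)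
    \<comment> \<open>Since \<open>F\<close> and \<open>M\<close> are real, the real and imaginary
      parts of \<open>W\<close> intertwine them separately, and so does each real
      combination.\<close>
    have re: "(\<Sum>k<n. F $$ (i, k) * Re (W $$ (k, j))) = (\<Sum>k<n. Re (W $$ (i, k)) * M $$ (k, j))"
      using arg_cong[OF eq, of Re] by simp
    have im: "(\<Sum>k<n. F $$ (i, k) * Im (W $$ (k, j))) = (\<Sum>k<n. Im (W $$ (i, k)) * M $$ (k, j))"
      using arg_cong[OF eq, of Im] by simp
    have "(F * V) $$ (i, j) = (\<Sum>k<n. F $$ (i, k) * Re (W $$ (k, j))) + t * (\<Sum>k<n. F $$ (i, k) * Im (W $$ (k, j)))"
      using i j F by (simp add: V_def scalar_prod_def atLeast0LessThan algebra_simps sum.distrib sum_distrib_left)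
    also have "\<dots> = (V * M) $$ (i, j)"
      unfolding re im using i j M
      by (simp add: V_def scalar_prod_def atLeast0LessThan algebra_simps sum.distrib sum_distrib_left)
    finally show "(F * V) $$ (i, j) = (V * M) $$ (i, j)" .
  qed (use F V M in auto)
  ultimately show ?thesis using V by blast
qed

section \<open>The synchronized regions\<close>

lemma exists_links_card_components:
  fixes T :: "real set" and \<beta> P :: real
  assumes "open T"
    and conv: "\<And>x y z. \<lbrakk>x \<in> T; z \<in> T; x \<le> y; y \<le> z\<rbrakk> \<Longrightarrow> y \<in> T"
    and "0 \<in> T" "\<beta> \<in> T" "\<beta> \<noteq> 0"
    and lower: "\<And>t. t \<in> T \<Longrightarrow> - P < t"
  shows "\<exists>c. card (components {\<alpha>. \<alpha> < 0 \<and> \<beta> * (\<Prod>i<m. 1 + c i * \<alpha>) \<in> T}) = m div 2 + 1"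
proof (cases "m div 2 = 0")
  case True
  \<comment> \<open>Constant links keep the value \<beta>, which lies in \<open>T\<close>, so the
    whole negative half-line is the only region.\<close>
  have "{\<alpha>. \<alpha> < 0 \<and> \<beta> * (\<Prod>i<m. 1 + 0 * \<alpha>) \<in> T} = {..<0::real}" using \<open>\<beta> \<in> T\<close> by auto
  moreover have "components {..<0::real} = {{..<0}}"
    by (rule components_open_partition) auto
  ultimately show ?thesis using True by (intro exI[of _ "\<lambda>_. 0"]) simp
next
  case False
  then show ?thesis by (intro card_components_prod_links[OF assms]) auto
qed

lemma stable_mat_iff_char_poly:
  assumes "G \<in> carrier_mat n n"
  shows "stable_mat G \<longleftrightarrow> stable_poly (char_poly G)"
proof -
  have "map_mat complex_of_real G \<in> carrier_mat n n" using assms by simp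
  then show ?thesis
    unfolding stable_mat_def stable_poly_def
    by (simp add: eigenvalue_root_char_poly of_real_hom.char_poly_hom[OF assms])
qed

lemma map_mat_cyclic_tridiagonal:
  "map_mat complex_of_real (cyclic_tridiagonal n d e l c)
   = cyclic_tridiagonal n (of_real \<circ> d) (of_real \<circ> e) (of_real \<circ> l) (of_real c)"
  by (intro eq_matI) (auto simp: cyclic_tridiagonal_def)

text \<open>The matrix with moving links is affine in \<open>x\<close>; its linear part becomes
  \<open>H\<close> after a change of basis.\<close>

lemma cyclic_tridiagonal_perturb:
  "cyclic_tridiagonal n d e (\<lambda>j. 1 + k j * x) (- b * (1 + k (n - 1) * x))
   = cyclic_tridiagonal n d e (\<lambda>_. 1) (- b)
     + x \<cdot>\<^sub>m cyclic_tridiagonal n (\<lambda>_. 0) (\<lambda>_. 0) k (- b * k (n - 1))"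
  by (intro eq_matI) (auto simp: cyclic_tridiagonal_def algebra_simps)

text \<open>The cyclic vector comes from the complex Jordan form, and
  \<open>real_intertwiner\<close> makes the resulting change of basis real.\<close>

lemma similar_to_cyclic_tridiagonal:
  fixes F :: "real mat"
  assumes F: "F \<in> carrier_mat n n" and "n \<ge> 1" and "one_jordan_block_per_eigenvalue F"
    and q0: "q 0 = 1" and q: "\<And>j. j < n \<Longrightarrow> q (Suc j) = [:- d j, 1:] * q j - Polynomial.smult (e j) (q (j - 1))"
    and "e 0 = 0" and qn: "q n = char_poly F - [:b:]"
  shows "\<exists>V\<in>carrier_mat n n. det V \<noteq> 0 \<and> F * V = V * cyclic_tridiagonal n d e (\<lambda>_. 1) (- b)"
proof -
  define A where "A = map_mat complex_of_real F"
  have A: "A \<in> carrier_mat n n" using F by (simp add: A_def)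
  have char: "char_poly A = cpoly (char_poly F)"
    unfolding A_def by (rule of_real_hom.char_poly_hom[OF F])
  obtain v where v: "v \<in> carrier_vec n" "annihilator_generator A n v (char_poly A)"
    using exists_annihilator_generator_char_poly[OF A] assms(3)
    unfolding one_jordan_block_per_eigenvalue_def A_def by blast
  have "degree (char_poly A) = n" using degree_monic_char_poly[OF A] by simp
  have "\<exists>W\<in>carrier_mat n n. det W \<noteq> 0 \<and>
      A * W = W * cyclic_tridiagonal n (of_real \<circ> d) (of_real \<circ> e) (\<lambda>_. 1) (- of_real b)"
  proof (rule exists_cyclic_basis[OF A \<open>n \<ge> 1\<close> v \<open>degree (char_poly A) = n\<close>, of "cpoly \<circ> q"])
    show "(cpoly \<circ> q) (Suc j) = [:- (of_real \<circ> d) j, 1:] * (cpoly \<circ> q) j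
        - Polynomial.smult ((of_real \<circ> e) j) ((cpoly \<circ> q) (j - 1))" if "j < n" for j
      unfolding comp_def q[OF that] by (simp add: hom_distribs del: mult_pCons_left)
  qed (use q0 qn \<open>e 0 = 0\<close> in \<open>simp_all add: char hom_distribs\<close>)
  moreover have "cyclic_tridiagonal n (of_real \<circ> d) (of_real \<circ> e) (\<lambda>_. 1) (- of_real b)
      = map_mat complex_of_real (cyclic_tridiagonal n d e (\<lambda>_. 1) (- b))"
    by (simp add: map_mat_cyclic_tridiagonal comp_def)
  ultimately show ?thesis
    using real_intertwiner[OF F cyclic_tridiagonal_carrier] unfolding A_def by metis
qed

theorem theorem2:
  fixes F :: "real mat" and n :: nat and \<gamma> :: "nat \<Rightarrow> real" and \<beta>0 :: real and p :: "real poly"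
  assumes "n \<ge> 1"
    and "F \<in> carrier_mat n n"
    and "stable_mat F"
    and "char_poly F = monom 1 n + (\<Sum>i<n. monom (\<gamma> i) i)"
    and "one_jordan_block_per_eigenvalue F"
    and "\<beta>0 \<noteq> 0"
    and "p = monom 1 n + (\<Sum>i<n. monom (\<gamma> i) i) - [:\<beta>0:]"
    and "stable_poly p"
  shows "\<exists>H \<in> carrier_mat n n.
           has_disconnected_stable_regions F H ((n - num_conjugate_pairs p) div 2 + 1)"
proof -
  note F = \<open>F \<in> carrier_mat n n\<close>
  have p: "p = char_poly F - [:\<beta>0:]" using assms(4,7) by simp
  then have p': "p = char_poly F + [:- \<beta>0:]" by simp
  have "degree (char_poly F) = n" "monic (char_poly F)" using degree_monic_char_poly[OF F] by auto
  then have deg: "degree p = n" and "monic p"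
    using lead_coeff_shift[of "char_poly F" "- \<beta>0"] \<open>n \<ge> 1\<close> unfolding p' by auto
  have deg1: "degree p \<ge> 1" using deg \<open>n \<ge> 1\<close> by simp
  \<comment> \<open>Shifts are measured from \<open>p\<close>: 0 gives \<open>p\<close> itself, and
    \<open>\<beta>0\<close> gives the characteristic polynomial of \<open>F\<close>.\<close>
  define T where "T = {b. stable_poly (p + [:b:])}"
  define m where "m = n - num_conjugate_pairs p"
  have "p + [:\<beta>0:] = char_poly F" by (simp add: p)
  then have "\<beta>0 \<in> T" using \<open>stable_mat F\<close> by (simp add: T_def stable_mat_iff_char_poly[OF F])
  have "0 \<in> T" using \<open>stable_poly p\<close> by (simp add: T_def)
  have "open T" unfolding T_def by (rule open_stable_shifts[OF \<open>monic p\<close> deg1])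
  have conv: "y \<in> T" if "x \<in> T" "z \<in> T" "x \<le> y" "y \<le> z" for x y z
    using stable_shifts_convex[OF \<open>monic p\<close> deg1] that unfolding T_def by blast
  have lower: "- poly p 0 < t" if "t \<in> T" for t
    using stable_shift_lower_bound[OF \<open>monic p\<close> deg1] that unfolding T_def by blast
  have "\<exists>c. card (components {\<alpha>. \<alpha> < 0 \<and> \<beta>0 * (\<Prod>i<m. 1 + c i * \<alpha>) \<in> T}) = m div 2 + 1"
    by (rule exists_links_card_components[where P = "poly p 0"])
      (fact \<open>open T\<close> conv \<open>0 \<in> T\<close> \<open>\<beta>0 \<in> T\<close> \<open>\<beta>0 \<noteq> 0\<close> lower)+
  then obtain c where c: "card (components {\<alpha>. \<alpha> < 0 \<and> \<beta>0 * (\<Prod>i<m. 1 + c i * \<alpha>) \<in> T}) = m div 2 + 1"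
    by blast
  obtain d e q where q0: "q 0 = 1"
    and q: "\<And>j. j < n \<Longrightarrow> q (Suc j) = [:- d j, 1:] * q j - Polynomial.smult (e j) (q (j - 1))"
    and qn: "q n = p" and e: "e 0 = 0"
    and count: "card {j. j < n \<and> e (Suc j) = 0} + num_conjugate_pairs p = n"
    using exists_three_term_recurrence[OF \<open>monic p\<close>] unfolding deg by blast
  \<comment> \<open>The positions where a factor ends are the links free to vary, since
    \<open>e\<close> vanishes there. There are \<open>m\<close> of them, and \<open>h\<close>
    assigns them the slopes \<open>c\<close>.\<close>
  define J where "J = {j. j < n \<and> e (Suc j) = 0}"
  have "finite J" "card J = m" using count by (auto simp: J_def m_def)
  then obtain h where h: "bij_betw h J {..<m}" using ex_bij_betw_finite_nat[of J] by (auto simp: atLeast0LessThan)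
  define k where "k j = (if j \<in> J then c (h j) else 0)" for j
  have ek: "e (Suc j) * k j = 0" for j by (simp add: k_def J_def)
  have prod: "(\<Prod>j<n. 1 + k j * x) = (\<Prod>i<m. 1 + c i * x)" for x
  proof -
    have "(\<Prod>j<n. 1 + k j * x) = (\<Prod>j\<in>J. 1 + c (h j) * x)"
      by (intro prod.mono_neutral_cong_right) (auto simp: k_def J_def)
    also have "\<dots> = (\<Prod>i<m. 1 + c i * x)" by (rule prod.reindex_bij_betw[OF h])
    finally show ?thesis .
  qed
  define M where "M = cyclic_tridiagonal n d e (\<lambda>_. 1) (- \<beta>0)"
  define K where "K = cyclic_tridiagonal n (\<lambda>_. 0) (\<lambda>_. 0) k (- \<beta>0 * k (n - 1))"
  have M: "M \<in> carrier_mat n n" and K: "K \<in> carrier_mat n n" by (simp_all add: M_def K_def)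
  have char: "char_poly (M + x \<cdot>\<^sub>m K) = p + [:\<beta>0 * (\<Prod>i<m. 1 + c i * x):]" for x
    unfolding M_def K_def cyclic_tridiagonal_perturb[symmetric]
    using char_poly_cyclic_tridiagonal[where q = q, OF \<open>n \<ge> 1\<close> q0 e q ek] by (simp only: qn prod)
  obtain V where V: "V \<in> carrier_mat n n" "det V \<noteq> 0" "F * V = V * M"
    using similar_to_cyclic_tridiagonal[OF F \<open>n \<ge> 1\<close> assms(5) q0 q e, of \<beta>0] qn p unfolding M_def by blast
  obtain V' where V': "V' \<in> carrier_mat n n" "V' * V = 1\<^sub>m n" "V * V' = 1\<^sub>m n"
    using det_non_zero_imp_unit[OF V(1,2), of "()"] by (auto simp: Units_def ring_mat_def)
  define H where "H = V * K * V'"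
  have H: "H \<in> carrier_mat n n" using V(1) V'(1) K by (simp add: H_def)
  have "similar_mat (F + x \<cdot>\<^sub>m H) (M + x \<cdot>\<^sub>m K)" for x
  proof -
    have "F = F * (V * V')" using F V' by simp
    also have "\<dots> = V * M * V'" using F V(1) V'(1) by (simp add: V(3) flip: assoc_mult_mat)
    finally have "F + x \<cdot>\<^sub>m H = V * M * V' + x \<cdot>\<^sub>m (V * K * V')" by (simp add: H_def)
    also have "x \<cdot>\<^sub>m (V * K * V') = V * (x \<cdot>\<^sub>m K) * V'"
      using V(1) V'(1) K by (simp add: mult_smult_distrib mult_smult_assoc_mat[of _ n n])
    also have "V * M * V' + V * (x \<cdot>\<^sub>m K) * V' = V * (M + x \<cdot>\<^sub>m K) * V'"
      using V(1) V'(1) K M by (simp add: mult_add_distrib_mat[of _ n n] add_mult_distrib_mat[of _ n n])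
    finally have "similar_mat_wit (F + x \<cdot>\<^sub>m H) (M + x \<cdot>\<^sub>m K) V V'"
      by (intro similar_mat_witI[OF V'(3,2)]) (use F H M K V V' in auto)
    then show ?thesis unfolding similar_mat_def by blast
  qed
  then have "char_poly (F + x \<cdot>\<^sub>m H) = p + [:\<beta>0 * (\<Prod>i<m. 1 + c i * x):]" for x
    using char_poly_similar char by metis
  then have "stable_mat (F + x \<cdot>\<^sub>m H) \<longleftrightarrow> \<beta>0 * (\<Prod>i<m. 1 + c i * x) \<in> T" for x
    using stable_mat_iff_char_poly[of "F + x \<cdot>\<^sub>m H" n] F H by (simp add: T_def)
  then have "stability_region F H = {\<alpha>. \<alpha> < 0 \<and> \<beta>0 * (\<Prod>i<m. 1 + c i * \<alpha>) \<in> T}"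
    unfolding stability_region_def by blast
  with c have "card (components (stability_region F H)) = m div 2 + 1" by simp
  \<comment> \<open>An infinite set has \<open>card\<close> 0, so a positive cardinality gives
    finiteness.\<close>
  moreover from this have "finite (components (stability_region F H))"
    by (intro card_ge_0_finite) simp
  ultimately show ?thesis
    using H unfolding has_disconnected_stable_regions_def m_def by blast
qed

end
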